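(* Let $G$ be a topological group. If $G$ admits a universal irreducible conic representation $(V_G,\tau)$, then $(V_G,\tau)$ is (up to isomorphism of conic representations) the degenerate conic representation belonging to the universal irreducible affine representation of $G$.
   Context: Topological linear spaces (real or complex) are Hausdorff. A cone $V$ is a subset of a topological linear space $X$ with point-separating continuous dual such that $ax+by\in V$ for all $x,y\in V$, $a,b\ge 0$. A section of $V$ is a set $L^{-1}(1)$, where $L:V\to\mathbb{R}_{\ge 0}$ is continuous, preserves non-negative linear combinations, and is strictly positive on $V\setminus\{0\}$. A conic representation $(V,\tau)$ of $G$ consists of a non-zero cone $V$ admitting a compact section and a continuous action $\tau:G\times V\to V$ such that each $\tau_g$ preserves non-negative linear combinations. It is irreducible if $V$ has no closed non-zero $G$-invariant sub-cone other than $V$. A homomorphism of conic representations is a continuous $G$-equivariant map that preserves non-negative linear combinations and does not vanish at any non-zero point. A universal irreducible conic representation of $G$ is an irreducible conic representation admitting a homomorphism to every irreducible conic representation of $G$. An affine representation of $G$ is a non-empty compact convex set $Q$ in a topological linear space $X$ with point-separating continuous dual, with a continuous action $\rho:G\times Q\to Q$ such that each $\rho_g$ preserves convex combinations; it is irreducible if it has no non-empty closed convex $G$-invariant proper subset. An affine homomorphism is a continuous $G$-equivariant map preserving convex combinations. The universal irreducible affine representation of $G$ is the irreducible affine representation (it always exists and is unique up to isomorphism) that admits an affine homomorphism onto every irreducible affine representation of $G$. The degenerate conic representation belonging to an affine representation $(Q,\rho)$ is the cone $V_Q=\{(tx,t):x\in Q,\ t\ge 0\}\subseteq X\oplus\mathbb{R}$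 with action $(tx,t)\mapsto(t\rho_g(x),t)$. *)

theory Defs
  imports "HOL-Analysis.Analysis" "HOL-Library.Function_Algebras"
begin

instantiation "fun" :: (type, real_vector) real_vector
begin

definition scaleR_fun :: "real \<Rightarrow> ('a \<Rightarrow> 'b) \<Rightarrow> 'a \<Rightarrow> 'b" where
  "scaleR_fun r f = (\<lambda>x. r *\<^sub>R f x)"

instance
  by standard (auto simp: scaleR_fun_def plus_fun_def fun_eq_iff algebra_simps)

end

text \<open>
  A topological linear space is a linear subspace of some real vector space type together with a
  topology on it, so that for a fixed type one can quantify over many different spaces.
  Complex spaces are covered by restriction of scalars: cones and convex sets only involve real
  scalars, and the complex continuous dual separates points iff the real one does.
\<close>

definition topological_linear_space :: "'a::real_vector topology \<Rightarrow> bool" where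
  "topological_linear_space X \<longleftrightarrow>
     subspace (topspace X) \<and>
     Hausdorff_space X \<and>
     continuous_map (prod_topology X X) X (\<lambda>(x, y). x + y) \<and>
     continuous_map (prod_topology euclideanreal X) X (\<lambda>(r, x). r *\<^sub>R x)"

definition continuous_functional :: "'a::real_vector topology \<Rightarrow> ('a \<Rightarrow> real) \<Rightarrow> bool" where
  "continuous_functional X f \<longleftrightarrow>
     continuous_map X euclideanreal f \<and>
     (\<forall>x\<in>topspace X. \<forall>y\<in>topspace X. \<forall>a b. f (a *\<^sub>R x + b *\<^sub>R y) = a * f x + b * f y)"

definition point_separating_dual :: "'a::real_vector topology \<Rightarrow> bool" where
  "point_separating_dual X \<longleftrightarrow>
     (\<forall>x\<in>topspace X. \<forall>y\<in>topspace X. x \<noteq> y \<longrightarrow> (\<exists>f. continuous_functional X f \<and> f x \<noteq> f y))"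

text \<open>
  The data of a conic or affine representation: the ambient space, the cone or convex set in it,
  and the action. Only the values of the action on \<open>points\<close> matter.
\<close>

record ('g, 'a) rep =
  ambient :: "'a topology"
  points :: "'a set"
  act :: "'g \<Rightarrow> 'a \<Rightarrow> 'a"

abbreviation points_topology :: "('g, 'a) rep \<Rightarrow> 'a topology" where
  "points_topology R \<equiv> subtopology (ambient R) (points R)"

text \<open>
  A topological group is a type of class \<^class>\<open>topological_group_add\<close>. The group law is
  written additively, but it is not assumed to be commutative.
\<close>

definition continuous_action :: "('g::topological_group_add, 'a) rep \<Rightarrow> bool" where
  "continuous_action R \<longleftrightarrow>
     continuous_map (prod_topology euclidean (points_topology R)) (points_topology R)
       (\<lambda>(g, x). act R g x) \<and>
     (\<forall>x\<in>points R. act R 0 x = x) \<and>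
     (\<forall>g h. \<forall>x\<in>points R. act R (g + h) x = act R g (act R h x))"

definition invariant_subset :: "('g, 'a) rep \<Rightarrow> 'a set \<Rightarrow> bool" where
  "invariant_subset R W \<longleftrightarrow> W \<subseteq> points R \<and> (\<forall>g. \<forall>x\<in>W. act R g x \<in> W)"

definition equivariant :: "('g, 'a) rep \<Rightarrow> ('g, 'b) rep \<Rightarrow> ('a \<Rightarrow> 'b) \<Rightarrow> bool" where
  "equivariant R S f \<longleftrightarrow> (\<forall>g. \<forall>x\<in>points R. f (act R g x) = act S g (f x))"


subsection \<open>Conic representations\<close>

definition closed_under_cone_ops :: "'a::real_vector set \<Rightarrow> bool" where
  "closed_under_cone_ops V \<longleftrightarrow> (\<forall>x\<in>V. \<forall>y\<in>V. \<forall>a\<ge>0. \<forall>b\<ge>0. a *\<^sub>R x + b *\<^sub>R y \<in> V)"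

definition is_cone :: "'a::real_vector topology \<Rightarrow> 'a set \<Rightarrow> bool" where
  "is_cone X V \<longleftrightarrow>
     topological_linear_space X \<and> point_separating_dual X \<and>
     V \<subseteq> topspace X \<and> closed_under_cone_ops V"

definition preserves_nonneg_combinations ::
    "'a::real_vector set \<Rightarrow> ('a \<Rightarrow> 'b::real_vector) \<Rightarrow> bool" where
  "preserves_nonneg_combinations V f \<longleftrightarrow>
     (\<forall>x\<in>V. \<forall>y\<in>V. \<forall>a\<ge>0. \<forall>b\<ge>0. f (a *\<^sub>R x + b *\<^sub>R y) = a *\<^sub>R f x + b *\<^sub>R f y)"

definition is_section :: "'a::real_vector topology \<Rightarrow> 'a set \<Rightarrow> 'a set \<Rightarrow> bool" where
  "is_section X V K \<longleftrightarrow>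
     (\<exists>L :: 'a \<Rightarrow> real.
        continuous_map (subtopology X V) (top_of_set {0..}) L \<and>
        preserves_nonneg_combinations V L \<and>
        (\<forall>x\<in>V. x \<noteq> 0 \<longrightarrow> L x > 0) \<and>
        K = {x\<in>V. L x = 1})"

definition conic_rep :: "('g::topological_group_add, 'a::real_vector) rep \<Rightarrow> bool" where
  "conic_rep R \<longleftrightarrow>
     is_cone (ambient R) (points R) \<and>
     (\<exists>x\<in>points R. x \<noteq> 0) \<and>
     (\<exists>K. is_section (ambient R) (points R) K \<and> compactin (ambient R) K) \<and>
     continuous_action R \<and>
     (\<forall>g. preserves_nonneg_combinations (points R) (act R g))"

definition irreducible_conic_rep ::
    "('g::topological_group_add, 'a::real_vector) rep \<Rightarrow> bool" where
  "irreducible_conic_rep R \<longleftrightarrow>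
     conic_rep R \<and>
     (\<forall>W. closedin (points_topology R) W \<and> closed_under_cone_ops W \<and>
          (\<exists>x\<in>W. x \<noteq> 0) \<and> invariant_subset R W \<longrightarrow> W = points R)"

definition conic_hom ::
    "('g, 'a::real_vector) rep \<Rightarrow> ('g, 'b::real_vector) rep \<Rightarrow> ('a \<Rightarrow> 'b) \<Rightarrow> bool" where
  "conic_hom R S f \<longleftrightarrow>
     continuous_map (points_topology R) (points_topology S) f \<and>
     equivariant R S f \<and>
     preserves_nonneg_combinations (points R) f \<and>
     (\<forall>x\<in>points R. x \<noteq> 0 \<longrightarrow> f x \<noteq> 0)"

definition conic_isomorphic ::
    "('g, 'a::real_vector) rep \<Rightarrow> ('g, 'b::real_vector) rep \<Rightarrow> bool" where
  "conic_isomorphic R S \<longleftrightarrow>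
     (\<exists>f f'. conic_hom R S f \<and> conic_hom S R f' \<and>
             (\<forall>x\<in>points R. f' (f x) = x) \<and> (\<forall>y\<in>points S. f (f' y) = y))"

text \<open>
  The universal properties quantify over all irreducible representations, whereas a HOL formula
  can only quantify over those living in one type. The type below is large enough to contain an
  isomorphic copy of every irreducible representation, conic or affine, of a group of type \<open>'g\<close>.
  For \<open>V \<subseteq> X\<close> irreducible, fix \<open>v\<^sub>0 \<in> V\<close> (non-zero in the conic case). The closed cone
  (closed convex set) in \<open>V\<close> generated by the orbit of \<open>v\<^sub>0\<close> is \<open>V\<close>, so the restriction to
  \<open>V\<close> of a continuous functional \<open>f\<close> is determined by the function \<open>g \<mapsto> f (g v\<^sub>0)\<close>. Map \<open>v\<close> to
  the element of \<open>('g \<Rightarrow> real) \<Rightarrow> real\<close> whose value at \<open>\<phi>\<close> is \<open>f v\<close> if \<open>\<phi> = (\<lambda>g. f (g v\<^sub>0))\<close> for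
  some \<open>f\<close> in the dual, and \<open>0\<close> otherwise. For the product topology this map is continuous, it is
  injective because the dual separates points, and it is a homeomorphism onto its image because
  \<open>V\<close> is compact or has a compact section.
\<close>

type_synonym 'g universe = "('g \<Rightarrow> real) \<Rightarrow> real"

definition universal_irreducible_conic_rep ::
    "('g::topological_group_add, 'a::real_vector) rep \<Rightarrow> bool" where
  "universal_irreducible_conic_rep R \<longleftrightarrow>
     irreducible_conic_rep R \<and>
     (\<forall>S :: ('g, 'g universe) rep. irreducible_conic_rep S \<longrightarrow> (\<exists>f. conic_hom R S f))"


subsection \<open>Affine representations\<close>

definition preserves_convex_combinations ::
    "'a::real_vector set \<Rightarrow> ('a \<Rightarrow> 'b::real_vector) \<Rightarrow> bool" where
  "preserves_convex_combinations Q f \<longleftrightarrow>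
     (\<forall>x\<in>Q. \<forall>y\<in>Q. \<forall>a\<ge>0. \<forall>b\<ge>0. a + b = 1 \<longrightarrow>
        f (a *\<^sub>R x + b *\<^sub>R y) = a *\<^sub>R f x + b *\<^sub>R f y)"

definition affine_rep :: "('g::topological_group_add, 'a::real_vector) rep \<Rightarrow> bool" where
  "affine_rep R \<longleftrightarrow>
     topological_linear_space (ambient R) \<and> point_separating_dual (ambient R) \<and>
     points R \<noteq> {} \<and> compactin (ambient R) (points R) \<and> convex (points R) \<and>
     continuous_action R \<and>
     (\<forall>g. preserves_convex_combinations (points R) (act R g))"

definition irreducible_affine_rep ::
    "('g::topological_group_add, 'a::real_vector) rep \<Rightarrow> bool" where
  "irreducible_affine_rep R \<longleftrightarrow>
     affine_rep R \<and>
     (\<forall>C. closedin (points_topology R) C \<and> convex C \<and> C \<noteq> {} \<and> invariant_subset R C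
          \<longrightarrow> C = points R)"

definition affine_hom ::
    "('g, 'a::real_vector) rep \<Rightarrow> ('g, 'b::real_vector) rep \<Rightarrow> ('a \<Rightarrow> 'b) \<Rightarrow> bool" where
  "affine_hom R S f \<longleftrightarrow>
     continuous_map (points_topology R) (points_topology S) f \<and>
     equivariant R S f \<and>
     preserves_convex_combinations (points R) f"

definition universal_irreducible_affine_rep ::
    "('g::topological_group_add, 'a::real_vector) rep \<Rightarrow> bool" where
  "universal_irreducible_affine_rep R \<longleftrightarrow>
     irreducible_affine_rep R \<and>
     (\<forall>S :: ('g, 'g universe) rep. irreducible_affine_rep S \<longrightarrow>
        (\<exists>f. affine_hom R S f \<and> f ` points R = points S))"


subsection \<open>Degenerate conic representations\<close>

text \<open>
  A point \<open>(y, t)\<close> of the cone with \<open>t > 0\<close> is \<open>(t x, t)\<close> for \<open>x = y / t\<close>; for \<open>t = 0\<close> it is the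
  apex, which the formula for the action fixes because of the factor \<open>t\<close>.
\<close>

definition degenerate_conic_rep ::
    "('g, 'a::real_vector) rep \<Rightarrow> ('g, 'a \<times> real) rep" where
  "degenerate_conic_rep R =
     \<lparr>ambient = prod_topology (ambient R) euclideanreal,
      points = {(t *\<^sub>R x, t) | x t. x \<in> points R \<and> 0 \<le> t},
      act = (\<lambda>g (y, t). (t *\<^sub>R act R g (inverse t *\<^sub>R y), t))\<rparr>"

lemma act_degenerate_conic_rep:
  "act (degenerate_conic_rep R) g (t *\<^sub>R x, t) = (t *\<^sub>R act R g x, t)"
  by (cases "t = 0") (simp_all add: degenerate_conic_rep_def)

end

theory Submission
  imports Defs
begin

text \<open>
  The half-line with trivial action is an irreducible conic representation, so a homomorphism from
  \<open>V\<close> to it is an invariant functional \<open>L\<close> that is strictly positive off the apex. Its section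
  \<open>K = {L = 1}\<close> is a compact convex invariant set, hence an irreducible affine representation, and
  \<open>V\<close> is the cone over \<open>K\<close>. Any other such functional \<open>M\<close> is a multiple of \<open>L\<close>, because
  \<open>{M = c L}\<close> is a closed invariant sub-cone; so every homomorphism from \<open>V\<close> to a degenerate
  conic representation restricts, after rescaling, to an affine homomorphism of \<open>K\<close>. Hence \<open>K\<close> is
  universal. Affine homomorphisms \<open>f, h\<close> between irreducible affine representations are unique: their
  midpoint is again a homomorphism, hence onto, so it attains the points at which a strictly convex
  function is maximal, and there \<open>f\<close> and \<open>h\<close> agree. Hence every universal irreducible affine
  representation is isomorphic to \<open>K\<close>.
\<close>

section \<open>Scalar multiples and compact sets in topological linear spaces\<close>

lemma continuous_map_tls_add:
  assumes "topological_linear_space X" "continuous_map Y X f" "continuous_map Y X g"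
  shows "continuous_map Y X (\<lambda>y. f y + g y)"
proof -
  have "continuous_map Y X ((\<lambda>(x, y). x + y) \<circ> (\<lambda>y. (f y, g y)))"
    using assms unfolding topological_linear_space_def
    by (blast intro: continuous_map_compose continuous_map_pairedI)
  then show ?thesis by (simp add: o_def)
qed

lemma continuous_map_tls_scaleR:
  assumes "topological_linear_space X" "continuous_map Y euclideanreal r" "continuous_map Y X f"
  shows "continuous_map Y X (\<lambda>y. r y *\<^sub>R f y)"
proof -
  have "continuous_map Y X ((\<lambda>(r, x). r *\<^sub>R x) \<circ> (\<lambda>y. (r y, f y)))"
    using assms unfolding topological_linear_space_def
    by (blast intro: continuous_map_compose continuous_map_pairedI)
  then show ?thesis by (simp add: o_def)
qed

text \<open>A tube-lemma argument: the pairs \<open>(x, t)\<close> with \<open>x\<close> in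
  \<open>C\<close> and \<open>t *\<^sub>R x\<close> outside \<open>U\<close> form a closed set.
  Projection along the compact factor \<open>C\<close> is a closed map, so the bad \<open>t\<close>
  form a closed set of reals, and that set misses \<open>0\<close>.\<close>

lemma tls_compact_absorbed:
  assumes X: "topological_linear_space X" and C: "compactin X C" and U: "openin X U" "0 \<in> U"
  obtains e :: real where "e > 0" "\<And>t x. \<bar>t\<bar> < e \<Longrightarrow> x \<in> C \<Longrightarrow> t *\<^sub>R x \<in> U"
proof -
  let ?C = "subtopology X C" and ?P = "prod_topology (subtopology X C) euclideanreal"
  have CX: "C \<subseteq> topspace X" by (rule compactin_subset_topspace[OF C])
  have "continuous_map ?P X (\<lambda>z. snd z *\<^sub>R fst z)"
    by (rule continuous_map_tls_scaleR[OF X continuous_map_snd])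
       (rule continuous_map_into_fulltopology[OF continuous_map_fst])
  then have cl: "closedin ?P {z \<in> topspace ?P. snd z *\<^sub>R fst z \<in> topspace X - U}"
    by (rule closedin_continuous_map_preimage) (use U in auto)
  have "closedin euclideanreal (snd ` {z \<in> topspace ?P. snd z *\<^sub>R fst z \<in> topspace X - U})"
    (is "closedin _ ?B")
    using closed_map_snd[of ?C euclideanreal] C cl by (simp add: closed_map_def compactin_subspace)
  then have "open (- ?B)" by (simp add: closed_def)
  moreover have "0 \<in> - ?B" using U by auto
  ultimately obtain e where e: "e > 0" "ball 0 e \<subseteq> - ?B"
    by (meson open_contains_ball)
  have "t *\<^sub>R x \<in> U" if "\<bar>t\<bar> < e" "x \<in> C" for t x
  proof -
    have "(x, t) \<in> topspace ?P" using that CX by auto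
    moreover have "t *\<^sub>R x \<in> topspace X"
      using X CX that by (auto simp: topological_linear_space_def subspace_def)
    ultimately have m: "(x, t) \<in> {z \<in> topspace ?P. snd z *\<^sub>R fst z \<in> topspace X - U}"
      if "t *\<^sub>R x \<notin> U" using that by simp
    have "t \<in> - ?B" by (rule subsetD[OF e(2)]) (use that in simp)
    then show ?thesis using imageI[OF m, of snd] unfolding snd_conv by blast
  qed
  then show ?thesis by (rule that[OF e(1)])
qed

text \<open>The issue is continuity at the zeros of \<open>r\<close>, near which \<open>k\<close> is
  controlled only through its values in the compact set \<open>C\<close>. A neighbourhood
  \<open>U\<close> of \<open>0\<close> absorbs \<open>C\<close>, so a small \<open>r y\<close>
  already forces \<open>r y *\<^sub>R k y\<close> into \<open>U\<close>. This later gives continuity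
  at the apex of a cone.\<close>

lemma continuous_map_scaleR_compact:
  assumes X: "topological_linear_space X" and C: "compactin X C"
    and r: "continuous_map Y euclideanreal r"
    and k: "continuous_map (subtopology Y {y. r y \<noteq> 0}) X k"
    and kC: "\<And>y. y \<in> topspace Y \<Longrightarrow> r y \<noteq> 0 \<Longrightarrow> k y \<in> C"
  shows "continuous_map Y X (\<lambda>y. r y *\<^sub>R k y)"
proof -
  let ?N = "{y \<in> topspace Y. r y \<noteq> 0}"
  have "openin Y {y \<in> topspace Y. r y \<in> - {0}}"
    by (rule openin_continuous_map_preimage[OF r]) (auto simp: open_closed)
  then have N: "openin Y ?N" by simp
  have sub: "subtopology Y {y. r y \<noteq> 0} = subtopology Y ?N"
    using subtopology_restrict[of Y "{y. r y \<noteq> 0}"] by (simp add: Int_def)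
  have kr: "continuous_map (subtopology Y ?N) X (\<lambda>y. r y *\<^sub>R k y)"
    using k unfolding sub
    by (intro continuous_map_tls_scaleR[OF X] continuous_map_from_subtopology[OF r])
  have X0: "0 \<in> topspace X" and Xs: "\<And>x t. x \<in> topspace X \<Longrightarrow> t *\<^sub>R x \<in> topspace X"
    using X by (auto simp: topological_linear_space_def subspace_def)
  have CX: "C \<subseteq> topspace X" by (rule compactin_subset_topspace[OF C])
  have "openin Y {y \<in> topspace Y. r y *\<^sub>R k y \<in> U}" if U: "openin X U" for U
  proof -
    have "openin (subtopology Y ?N) {y \<in> topspace (subtopology Y ?N). r y *\<^sub>R k y \<in> U}"
      by (rule openin_continuous_map_preimage[OF kr U])
    then have A: "openin Y {y \<in> ?N. r y *\<^sub>R k y \<in> U}" (is "openin Y ?A")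
      using N by (auto simp: openin_open_subtopology Int_def conj_ac cong: conj_cong)
    show ?thesis
    proof (cases "0 \<in> U")
      case False
      then have "{y \<in> topspace Y. r y *\<^sub>R k y \<in> U} = ?A" by auto
      with A show ?thesis by simp
    next
      case True
      obtain e :: real where e: "e > 0" "\<And>t x. \<bar>t\<bar> < e \<Longrightarrow> x \<in> C \<Longrightarrow> t *\<^sub>R x \<in> U"
        using tls_compact_absorbed[OF X C U True] by blast
      have "openin Y {y \<in> topspace Y. r y \<in> {-e<..<e}}"
        by (rule openin_continuous_map_preimage[OF r]) simp
      moreover have "{y \<in> topspace Y. r y *\<^sub>R k y \<in> U} = ?A \<union> {y \<in> topspace Y. r y \<in> {-e<..<e}}"
      proof -
        have "r y *\<^sub>R k y \<in> U" if "y \<in> topspace Y" "r y \<in> {-e<..<e}" for y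
          using True e(2)[of "r y" "k y"] kC[of y] that by (cases "r y = 0") auto
        then show ?thesis using e(1) True by auto
      qed
      ultimately show ?thesis using A by auto
    qed
  qed
  moreover have "r y *\<^sub>R k y \<in> topspace X" if "y \<in> topspace Y" for y
    using kC[OF that] CX X0 Xs by (cases "r y = 0") auto
  ultimately show ?thesis by (auto simp: continuous_map_def)
qed

section \<open>Function spaces and products as topological linear spaces\<close>

lemma topological_linear_space_fun:
  "topological_linear_space (euclidean :: ('i \<Rightarrow> real) topology)"
proof -
  have "continuous_map (prod_topology euclidean euclidean) euclidean (\<lambda>(x, y). x + y :: 'i \<Rightarrow> real)"
    unfolding euclidean_product_topology[symmetric] continuous_map_componentwise_UNIV case_prod_unfold plus_fun_def
    by (intro allI continuous_map_add) 
      (auto intro!: continuous_map_compose[unfolded o_def, OF continuous_map_fst continuous_map_product_projection]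
         continuous_map_compose[unfolded o_def, OF continuous_map_snd continuous_map_product_projection])
  moreover have "continuous_map (prod_topology euclideanreal euclidean) euclidean (\<lambda>(r, x). r *\<^sub>R x :: 'i \<Rightarrow> real)"
    unfolding euclidean_product_topology[symmetric] continuous_map_componentwise_UNIV case_prod_unfold scaleR_fun_def real_scaleR_def
    by (intro allI continuous_map_real_mult continuous_map_fst)
      (auto intro!: continuous_map_compose[unfolded o_def, OF continuous_map_snd continuous_map_product_projection])
  moreover have "Hausdorff_space (euclidean :: ('i \<Rightarrow> real) topology)"
    unfolding euclidean_product_topology[symmetric] by (simp add: Hausdorff_space_product_topology)
  ultimately show ?thesis by (simp add: topological_linear_space_def)
qed

lemma continuous_map_apply: "continuous_map euclidean euclideanreal (\<lambda>x :: 'i \<Rightarrow> real. x i)"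
  unfolding euclidean_product_topology[symmetric] by (intro continuous_map_product_projection UNIV_I)

lemma point_separating_dual_fun: "point_separating_dual (euclidean :: ('i \<Rightarrow> real) topology)"
proof -
  have "continuous_functional euclidean (\<lambda>x :: 'i \<Rightarrow> real. x i)" for i
    by (simp add: continuous_functional_def continuous_map_apply plus_fun_def scaleR_fun_def
        del: continuous_map_iff_continuous2)
  then show ?thesis unfolding point_separating_dual_def by (metis ext)
qed

lemma topological_linear_space_prod:
  assumes X: "topological_linear_space X" and Y: "topological_linear_space Y"
  shows "topological_linear_space (prod_topology X Y)"
proof -
  let ?P = "prod_topology X Y"
  have f: "continuous_map ?P X fst" and s: "continuous_map ?P Y snd"
    by (rule continuous_map_fst continuous_map_snd)+
  have "continuous_map (prod_topology ?P ?P) ?P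
      (\<lambda>z. (fst (fst z) + fst (snd z), snd (fst z) + snd (snd z)))"
    by (intro continuous_map_pairedI continuous_map_tls_add[OF X] continuous_map_tls_add[OF Y])
      (rule continuous_map_compose[OF continuous_map_fst f, unfolded o_def]
        continuous_map_compose[OF continuous_map_snd f, unfolded o_def]
        continuous_map_compose[OF continuous_map_fst s, unfolded o_def]
        continuous_map_compose[OF continuous_map_snd s, unfolded o_def])+
  moreover have "continuous_map (prod_topology euclideanreal ?P) ?P
      (\<lambda>z. (fst z *\<^sub>R fst (snd z), fst z *\<^sub>R snd (snd z)))"
    by (intro continuous_map_pairedI continuous_map_tls_scaleR[OF X] continuous_map_tls_scaleR[OF Y])
      (rule continuous_map_fst continuous_map_compose[OF continuous_map_snd f, unfolded o_def]
        continuous_map_compose[OF continuous_map_snd s, unfolded o_def])+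
  moreover have "subspace (topspace ?P)"
    using X Y by (auto simp: topological_linear_space_def intro: subspace_Times)
  moreover have "Hausdorff_space ?P"
    using X Y by (simp add: topological_linear_space_def Hausdorff_space_prod_topology)
  ultimately show ?thesis
    by (simp add: topological_linear_space_def case_prod_unfold plus_prod_def scaleR_prod_def)
qed

lemma topological_linear_space_real: "topological_linear_space euclideanreal"
proof -
  have "continuous_map (prod_topology euclideanreal euclideanreal) euclideanreal (\<lambda>z. fst z + snd z)"
    by (intro continuous_map_add continuous_map_fst continuous_map_snd)
  moreover have "continuous_map (prod_topology euclideanreal euclideanreal) euclideanreal (\<lambda>z. fst z * snd z)"
    by (intro continuous_map_real_mult continuous_map_fst continuous_map_snd)
  ultimately show ?thesis
    by (simp add: topological_linear_space_def case_prod_unfold)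
qed

section \<open>Cones with a positive functional, and extension from a section\<close>

text \<open>The algebraic half of the functional in \<open>is_section\<close>; continuity is carried
  as a separate hypothesis.\<close>

definition positive_functional :: "'a::real_vector set \<Rightarrow> ('a \<Rightarrow> real) \<Rightarrow> bool" where
  "positive_functional V L \<longleftrightarrow>
     preserves_nonneg_combinations V L \<and> (\<forall>x\<in>V. x \<noteq> 0 \<longrightarrow> L x > 0)"

lemma cone_scaleR:
  assumes "closed_under_cone_ops V" "x \<in> V" "0 \<le> a"
  shows "a *\<^sub>R x \<in> V"
proof -
  have "a *\<^sub>R x + 0 *\<^sub>R x \<in> V" using assms unfolding closed_under_cone_ops_def by blast
  then show ?thesis by simp
qed

lemma cone_zero: "closed_under_cone_ops V \<Longrightarrow> x \<in> V \<Longrightarrow> 0 \<in> V"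
  using cone_scaleR[of V x 0] by simp

lemma preserves_scaleR:
  assumes "preserves_nonneg_combinations V f" "x \<in> V" "0 \<le> a"
  shows "f (a *\<^sub>R x) = a *\<^sub>R f x"
proof -
  have "f (a *\<^sub>R x + 0 *\<^sub>R x) = a *\<^sub>R f x + 0 *\<^sub>R f x"
    using assms unfolding preserves_nonneg_combinations_def by blast
  then show ?thesis by simp
qed

lemma preserves_nonneg_imp_convex:
  "preserves_nonneg_combinations V f \<Longrightarrow> Q \<subseteq> V \<Longrightarrow> preserves_convex_combinations Q f"
  unfolding preserves_nonneg_combinations_def preserves_convex_combinations_def by blast

lemma convex_cone: "closed_under_cone_ops V \<Longrightarrow> convex V"
  unfolding closed_under_cone_ops_def convex_def by blast

lemma positive_functional_scaleR:
  "positive_functional V L \<Longrightarrow> x \<in> V \<Longrightarrow> 0 \<le> a \<Longrightarrow> L (a *\<^sub>R x) = a * L x"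
  using preserves_scaleR[of V L x a] by (simp add: positive_functional_def)

lemma positive_functional_zero:
  "positive_functional V L \<Longrightarrow> x \<in> V \<Longrightarrow> L 0 = 0"
  using positive_functional_scaleR[of V L x 0] by simp

lemma positive_functional_nonneg:
  "positive_functional V L \<Longrightarrow> x \<in> V \<Longrightarrow> 0 \<le> L x"
  using positive_functional_zero[of V L x] by (cases "x = 0") (auto simp: positive_functional_def less_imp_le)

lemma positive_functional_eq_0_iff:
  "positive_functional V L \<Longrightarrow> x \<in> V \<Longrightarrow> L x = 0 \<longleftrightarrow> x = 0"
  using positive_functional_zero[of V L x] by (cases "x = 0") (auto simp: positive_functional_def)

lemma positive_functional_normalize:
  assumes "closed_under_cone_ops V" "positive_functional V L" "x \<in> V" "L x \<noteq> 0"
  shows "x /\<^sub>R L x \<in> {x \<in> V. L x = 1}"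
  using assms positive_functional_nonneg[of V L x]
  by (simp add: cone_scaleR positive_functional_scaleR)

lemma convex_section:
  assumes "closed_under_cone_ops V" "positive_functional V L"
  shows "convex {x \<in> V. L x = 1}"
  using assms unfolding convex_def closed_under_cone_ops_def positive_functional_def
    preserves_nonneg_combinations_def by auto

text \<open>Normalizing \<open>a *\<^sub>R x + b *\<^sub>R y\<close> by its value \<open>u\<close>
  under \<open>L\<close> gives the convex combination of the normalized points with weights
  \<open>a * L x / u\<close> and \<open>b * L y / u\<close>, to which \<open>f\<close> applies. At
  the apex the factor \<open>L x = 0\<close> cancels whatever \<open>f\<close> returns.\<close>

lemma homogeneous_extension:
  assumes V: "closed_under_cone_ops V" and L: "positive_functional V L"
    and f: "preserves_convex_combinations {x \<in> V. L x = 1} f"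
  shows "preserves_nonneg_combinations V (\<lambda>x. L x *\<^sub>R f (x /\<^sub>R L x))"
  unfolding preserves_nonneg_combinations_def
proof (intro ballI allI impI)
  fix x y and a b :: real
  assume x: "x \<in> V" and y: "y \<in> V" and a: "0 \<le> a" and b: "0 \<le> b"
  define u where "u = a * L x + b * L y"
  have Lu: "L (a *\<^sub>R x + b *\<^sub>R y) = u"
    using L x y a b by (simp add: positive_functional_def preserves_nonneg_combinations_def u_def)
  have Lx: "0 \<le> L x" and Ly: "0 \<le> L y" using positive_functional_nonneg[OF L] x y by auto
  have nn: "0 \<le> a * L x" "0 \<le> b * L y" using a b Lx Ly by auto
  show "L (a *\<^sub>R x + b *\<^sub>R y) *\<^sub>R f ((a *\<^sub>R x + b *\<^sub>R y) /\<^sub>R L (a *\<^sub>R x + b *\<^sub>R y)) =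
      a *\<^sub>R (L x *\<^sub>R f (x /\<^sub>R L x)) + b *\<^sub>R (L y *\<^sub>R f (y /\<^sub>R L y))"
  proof (cases "a * L x = 0 \<or> b * L y = 0")
    case True
    \<comment> \<open>A vanishing weight means that the coefficient is \<open>0\<close> or the point
      is the apex; that summand disappears and only homogeneity in the other one is left.\<close>
    then have True': "a *\<^sub>R x = 0 \<and> a * L x = 0 \<or> b *\<^sub>R y = 0 \<and> b * L y = 0"
      using positive_functional_eq_0_iff[OF L x] positive_functional_eq_0_iff[OF L y] by auto
    have cancel: "c \<noteq> 0 \<Longrightarrow> inverse c * inverse d * c = inverse d" for c d :: real by simp
    from True' show ?thesis
      unfolding Lu by (cases "a = 0"; cases "b = 0") (auto simp: u_def cancel)
  next
    case False
    then have nz: "L x \<noteq> 0" "L y \<noteq> 0" by auto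
    have u: "u > 0" using False nn unfolding u_def by linarith
    let ?p = "x /\<^sub>R L x" and ?q = "y /\<^sub>R L y"
    have pq: "?p \<in> {x \<in> V. L x = 1}" "?q \<in> {x \<in> V. L x = 1}"
      using positive_functional_normalize[OF V L] x y nz by blast+
    have one: "a * L x / u + b * L y / u = 1" using u by (simp add: u_def add_divide_distrib[symmetric])
    have "(a * L x / u) *\<^sub>R ?p + (b * L y / u) *\<^sub>R ?q = (a *\<^sub>R x + b *\<^sub>R y) /\<^sub>R u"
      using nz by (simp add: scaleR_add_right field_simps)
    moreover have "f ((a * L x / u) *\<^sub>R ?p + (b * L y / u) *\<^sub>R ?q) =
        (a * L x / u) *\<^sub>R f ?p + (b * L y / u) *\<^sub>R f ?q"
      using pq one nn u
      by (intro f[unfolded preserves_convex_combinations_def, rule_format]) auto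
    ultimately have "f ((a *\<^sub>R x + b *\<^sub>R y) /\<^sub>R u) =
        (a * L x / u) *\<^sub>R f ?p + (b * L y / u) *\<^sub>R f ?q"
      by metis
    then show ?thesis
      unfolding Lu using u by (simp add: scaleR_add_right)
  qed
qed

lemma continuous_map_normalize:
  assumes X: "topological_linear_space X" and V: "closed_under_cone_ops V"
    and L: "positive_functional V L" and cL: "continuous_map (subtopology X V) euclideanreal L"
  shows "continuous_map (subtopology X {x \<in> V. L x \<noteq> 0}) (subtopology X {x \<in> V. L x = 1})
    (\<lambda>x. x /\<^sub>R L x)"
proof (rule continuous_map_into_subtopology)
  have "continuous_map (subtopology X {x \<in> V. L x \<noteq> 0}) euclideanreal L"
    by (rule continuous_map_from_subtopology_mono[OF cL]) auto
  then show "continuous_map (subtopology X {x \<in> V. L x \<noteq> 0}) X (\<lambda>x. x /\<^sub>R L x)"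
    by (intro continuous_map_tls_scaleR[OF X] continuous_map_real_inverse
        continuous_map_id_subt[unfolded id_def]) auto
next
  show "(\<lambda>x. x /\<^sub>R L x) \<in> topspace (subtopology X {x \<in> V. L x \<noteq> 0}) \<rightarrow> {x \<in> V. L x = 1}"
    using positive_functional_normalize[OF V L] by auto
qed

text \<open>Away from the apex this is a composition with the normalization. At the apex,
  compactness of the section keeps the values of \<open>f\<close> in a compact set, so
  \<open>continuous_map_scaleR_compact\<close> applies.\<close>

lemma continuous_homogeneous_extension:
  assumes X: "topological_linear_space X" and V: "closed_under_cone_ops V"
    and L: "positive_functional V L" and cL: "continuous_map (subtopology X V) euclideanreal L"
    and K: "compactin X {x \<in> V. L x = 1}"
    and Y: "topological_linear_space Y" and f: "continuous_map (subtopology X {x \<in> V. L x = 1}) Y f"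
  shows "continuous_map (subtopology X V) Y (\<lambda>x. L x *\<^sub>R f (x /\<^sub>R L x))"
proof (rule continuous_map_scaleR_compact[OF Y _ cL])
  show "compactin Y (f ` {x \<in> V. L x = 1})"
    by (rule image_compactin[OF _ f]) (simp add: K compactin_subtopology)
  show "continuous_map (subtopology (subtopology X V) {y. L y \<noteq> 0}) Y (\<lambda>x. f (x /\<^sub>R L x))"
    using continuous_map_compose[OF continuous_map_normalize[OF X V L cL] f]
    by (simp add: subtopology_subtopology o_def Int_def)
  show "f (y /\<^sub>R L y) \<in> f ` {x \<in> V. L x = 1}"
    if "y \<in> topspace (subtopology X V)" "L y \<noteq> 0" for y
    using that positive_functional_normalize[OF V L] by auto
qed

text \<open>A non-negative combination of \<open>s *\<^sub>R p\<close> and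
  \<open>t *\<^sub>R q\<close> is \<open>u = a * s + b * t\<close> times a convex combination of
  \<open>p\<close> and \<open>q\<close>, or \<open>0\<close> when \<open>u = 0\<close>.\<close>

lemma cone_over_convex:
  assumes "convex C"
  shows "closed_under_cone_ops {t *\<^sub>R x | x t. x \<in> C \<and> 0 \<le> t}"
  unfolding closed_under_cone_ops_def
proof (intro ballI allI impI)
  fix x y and a b :: real
  assume "x \<in> {t *\<^sub>R x | x t. x \<in> C \<and> 0 \<le> t}" "y \<in> {t *\<^sub>R x | x t. x \<in> C \<and> 0 \<le> t}"
    and a: "0 \<le> a" and b: "0 \<le> b"
  then obtain p q s t where p: "p \<in> C" "0 \<le> s" "x = s *\<^sub>R p" and q: "q \<in> C" "0 \<le> t" "y = t *\<^sub>R q"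
    by blast
  define u where "u = a * s + b * t"
  have nn: "0 \<le> a * s" "0 \<le> b * t" using a b p q by auto
  show "a *\<^sub>R x + b *\<^sub>R y \<in> {t *\<^sub>R x | x t. x \<in> C \<and> 0 \<le> t}"
  proof (cases "u = 0")
    case True
    then have "a * s = 0" "b * t = 0" using nn unfolding u_def by linarith+
    then have "a *\<^sub>R x + b *\<^sub>R y = 0 *\<^sub>R p" by (auto simp: p q)
    with p show ?thesis by blast
  next
    case False
    then have u: "u > 0" using nn unfolding u_def by linarith
    let ?r = "(a * s / u) *\<^sub>R p + (b * t / u) *\<^sub>R q"
    have "a * s / u + b * t / u = 1" using u by (simp add: u_def add_divide_distrib[symmetric])
    then have "?r \<in> C" using assms p q nn u by (intro convexD) auto
    moreover have "a *\<^sub>R x + b *\<^sub>R y = u *\<^sub>R ?r" using u by (simp add: p q scaleR_add_right)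
    ultimately show ?thesis using less_imp_le[OF u] by blast
  qed
qed

section \<open>Affine representations: surjectivity and uniqueness of homomorphisms\<close>

lemma affine_rep_subset_topspace: "affine_rep R \<Longrightarrow> points R \<subseteq> topspace (ambient R)"
  by (auto simp: affine_rep_def dest: compactin_subset_topspace)

lemma topspace_points_topology: "affine_rep R \<Longrightarrow> topspace (points_topology R) = points R"
  using affine_rep_subset_topspace[of R] by auto

lemma affine_rep_Hausdorff: "affine_rep R \<Longrightarrow> Hausdorff_space (points_topology R)"
  by (simp add: affine_rep_def topological_linear_space_def Hausdorff_space_subtopology)

lemma affine_rep_compact: "affine_rep R \<Longrightarrow> compact_space (points_topology R)"
  by (simp add: affine_rep_def compactin_subspace)

lemma continuous_action_maps:
  assumes "continuous_action R" "points R \<subseteq> topspace (ambient R)" "x \<in> points R"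
  shows "act R g x \<in> points R"
proof -
  have "(\<lambda>(g, x). act R g x) \<in> topspace (prod_topology euclidean (points_topology R)) \<rightarrow> topspace (points_topology R)"
    using assms(1) unfolding continuous_action_def by (blast dest: continuous_map_funspace)
  then have "act R g x \<in> topspace (points_topology R)" using assms by (auto simp: Pi_iff)
  then show ?thesis by simp
qed

lemma affine_rep_act:
  "affine_rep R \<Longrightarrow> x \<in> points R \<Longrightarrow> act R g x \<in> points R"
  by (meson affine_rep_def affine_rep_subset_topspace continuous_action_maps)

lemma continuous_act:
  assumes "continuous_action R"
  shows "continuous_map (points_topology R) (points_topology R) (act R g)"
proof -
  have "continuous_map (points_topology R) (points_topology R) ((\<lambda>(g, x). act R g x) \<circ> (\<lambda>x. (g, x)))"
    using assms unfolding continuous_action_def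
    by (intro continuous_map_compose[where X' = "prod_topology euclidean (points_topology R)"]
        continuous_map_pairedI continuous_map_id[unfolded id_def]) auto
  then show ?thesis by (simp add: o_def)
qed

lemma affine_hom_maps:
  assumes "affine_rep R" "affine_hom R S f" "x \<in> points R"
  shows "f x \<in> points S"
proof -
  have "f \<in> topspace (points_topology R) \<rightarrow> topspace (points_topology S)"
    using assms(2) unfolding affine_hom_def by (blast dest: continuous_map_funspace)
  then show ?thesis using assms(3) unfolding topspace_points_topology[OF assms(1)] by (auto simp: Pi_iff)
qed

lemma affine_hom_compose:
  assumes R: "affine_rep R" and f: "affine_hom R S f" and h: "affine_hom S T h"
  shows "affine_hom R T (\<lambda>x. h (f x))"
  using f h affine_hom_maps[OF R f] 
    continuous_map_compose[of "points_topology R" "points_topology S" f "points_topology T" h]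
  unfolding affine_hom_def equivariant_def preserves_convex_combinations_def o_def by simp

lemma affine_hom_id: "affine_hom R R (\<lambda>x. x)"
  by (simp add: affine_hom_def equivariant_def preserves_convex_combinations_def)

lemma convex_image_preserves:
  assumes "preserves_convex_combinations Q f" "convex Q"
  shows "convex (f ` Q)"
proof (rule convexI)
  fix x y and a b :: real
  assume "x \<in> f ` Q" "y \<in> f ` Q" and ab: "0 \<le> a" "0 \<le> b" "a + b = 1"
  then obtain p q where p: "p \<in> Q" "x = f p" and q: "q \<in> Q" "y = f q" by blast
  then have "a *\<^sub>R x + b *\<^sub>R y = f (a *\<^sub>R p + b *\<^sub>R q)"
    using assms(1) ab unfolding preserves_convex_combinations_def by simp
  then show "a *\<^sub>R x + b *\<^sub>R y \<in> f ` Q"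
    using assms(2) p q ab by (simp add: convexD)
qed

lemma convex_preimage_preserves:
  assumes "preserves_convex_combinations Q f" "convex Q" "convex C"
  shows "convex {x \<in> Q. f x \<in> C}"
  using assms unfolding preserves_convex_combinations_def convex_def by simp

lemma convex_equalizer_preserves:
  assumes "preserves_convex_combinations Q f" "preserves_convex_combinations Q h" "convex Q"
  shows "convex {x \<in> Q. f x = h x}"
  using assms unfolding preserves_convex_combinations_def convex_def by simp

lemma preserves_convex_combinations_inv:
  assumes "preserves_convex_combinations Q f" "convex Q" "\<And>x. x \<in> Q \<Longrightarrow> h (f x) = x"
  shows "preserves_convex_combinations (f ` Q) h"
  unfolding preserves_convex_combinations_def
proof (intro ballI allI impI)
  fix x y and a b :: real
  assume "x \<in> f ` Q" "y \<in> f ` Q" and ab: "0 \<le> a" "0 \<le> b" "a + b = 1"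
  then obtain p q where p: "p \<in> Q" "x = f p" and q: "q \<in> Q" "y = f q" by blast
  then have "a *\<^sub>R x + b *\<^sub>R y = f (a *\<^sub>R p + b *\<^sub>R q)"
    using assms(1) ab unfolding preserves_convex_combinations_def by simp
  then show "h (a *\<^sub>R x + b *\<^sub>R y) = a *\<^sub>R h x + b *\<^sub>R h y"
    using assms p q ab by (simp add: convexD)
qed

text \<open>The image of a compact set is compact, hence closed in a Hausdorff space. Being also
  non-empty, convex and invariant, it exhausts the irreducible target.\<close>

lemma affine_hom_onto:
  assumes R: "affine_rep R" and S: "irreducible_affine_rep S" and f: "affine_hom R S f"
  shows "f ` points R = points S"
proof -
  have aS: "affine_rep S" using S by (simp add: irreducible_affine_rep_def)
  have "compactin (points_topology S) (f ` topspace (points_topology R))"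
    using f affine_rep_compact[OF R] unfolding affine_hom_def compact_space_def
    by (blast intro: image_compactin)
  then have "closedin (points_topology S) (f ` points R)"
    unfolding topspace_points_topology[OF R]
    by (rule compactin_imp_closedin[OF affine_rep_Hausdorff[OF aS]])
  moreover have "convex (f ` points R)"
    using R f by (intro convex_image_preserves) (auto simp: affine_rep_def affine_hom_def)
  moreover have "f ` points R \<noteq> {}" using R by (simp add: affine_rep_def)
  moreover have "invariant_subset S (f ` points R)"
    unfolding invariant_subset_def
  proof (intro conjI allI ballI)
    show "f ` points R \<subseteq> points S" using affine_hom_maps[OF R f] by blast
    fix g y assume "y \<in> f ` points R"
    then obtain x where x: "x \<in> points R" "y = f x" by blast
    then have "act S g y = f (act R g x)" using f by (simp add: affine_hom_def equivariant_def)
    then show "act S g y \<in> f ` points R" using affine_rep_act[OF R] x by blast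
  qed
  ultimately show ?thesis using S unfolding irreducible_affine_rep_def by blast
qed

text \<open>The group acts by maps that respect midpoints, so averaging keeps equivariance;
  convexity keeps the values inside \<open>points S\<close>. The average serves to compare
  \<open>f\<close> with \<open>h\<close>.\<close>

lemma affine_hom_midpoint:
  assumes R: "affine_rep R" and S: "affine_rep S"
    and f: "affine_hom R S f" and h: "affine_hom R S h"
  shows "affine_hom R S (\<lambda>x. (1/2) *\<^sub>R f x + (1/2) *\<^sub>R h x)"
proof -
  have m: "(1/2) *\<^sub>R f x + (1/2) *\<^sub>R h x \<in> points S" if "x \<in> points R" for x
    using S affine_hom_maps[OF R f that] affine_hom_maps[OF R h that]
    by (intro convexD) (auto simp: affine_rep_def)
  have X: "topological_linear_space (ambient S)" using S by (simp add: affine_rep_def)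
  have "continuous_map (points_topology R) (ambient S) (\<lambda>x. (1/2) *\<^sub>R f x + (1/2) *\<^sub>R h x)"
    using f h by (intro continuous_map_tls_add[OF X] continuous_map_tls_scaleR[OF X])
      (auto simp: affine_hom_def intro: continuous_map_into_fulltopology)
  then have "continuous_map (points_topology R) (points_topology S) (\<lambda>x. (1/2) *\<^sub>R f x + (1/2) *\<^sub>R h x)"
    by (rule continuous_map_into_subtopology) (use m in auto)
  moreover have "act S g ((1/2) *\<^sub>R f x + (1/2) *\<^sub>R h x) = (1/2) *\<^sub>R act S g (f x) + (1/2) *\<^sub>R act S g (h x)"
    if "x \<in> points R" for g x
    using S affine_hom_maps[OF R f that] affine_hom_maps[OF R h that]
    by (simp add: affine_rep_def preserves_convex_combinations_def)
  ultimately show ?thesis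
    using f h by (simp add: affine_hom_def equivariant_def preserves_convex_combinations_def algebra_simps)
qed

text \<open>Sums of squares over finite sets of continuous functionals take the place of one
  strictly convex function. Each finite set yields a point where its members do not distinguish
  \<open>f\<close> from \<open>h\<close>, and compactness combines these points into one.\<close>

lemma affine_hom_unique:
  fixes R :: "('g::topological_group_add, 'b::real_vector) rep"
    and S :: "('g, 'c::real_vector) rep"
  assumes R: "irreducible_affine_rep R" and S: "irreducible_affine_rep S"
    and f: "affine_hom R S f" and h: "affine_hom R S h" and x: "x \<in> points R"
  shows "f x = h x"
proof -
  let ?T = "points_topology R"
  have aR: "affine_rep R" and aS: "affine_rep S" using R S by (simp_all add: irreducible_affine_rep_def)
  note top = topspace_points_topology[OF aR]
  define D where "D = {u. continuous_functional (ambient S) u}"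
  have uf: "continuous_map ?T euclideanreal (\<lambda>x. u (k x))" if "u \<in> D" "affine_hom R S k" for u k
    using continuous_map_compose[of ?T "ambient S" k euclideanreal u] that
    unfolding D_def continuous_functional_def affine_hom_def o_def
    by (blast intro: continuous_map_into_fulltopology)
  \<comment> \<open>\<open>E u\<close> consists of the points at which \<open>u\<close> does not
    tell \<open>f\<close> from \<open>h\<close>; these closed sets are intersected over all
    functionals below.\<close>
  define E where "E u = {x \<in> points R. u (f x) = u (h x)}" for u :: "'c \<Rightarrow> real"
  have clE: "closedin ?T (E u)" if "u \<in> D" for u
    using closedin_continuous_maps_eq[OF _ uf[OF that f] uf[OF that h]] unfolding top E_def by simp
  have fin: "\<exists>x\<in>points R. \<forall>u\<in>F. u (f x) = u (h x)" if F: "finite F" "F \<subseteq> D" for F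
  proof -
    let ?m = "\<lambda>x. (1/2) *\<^sub>R f x + (1/2) *\<^sub>R h x"
    \<comment> \<open>The parallelogram identity forces the functionals in \<open>F\<close> to agree on \<open>f x\<close> and \<open>h x\<close>
      when the midpoint of \<open>f x\<close> and \<open>h x\<close> maximizes \<open>N\<close>.\<close>
    define N where "N y = (\<Sum>u\<in>F. (u y)\<^sup>2)" for y
    have cont: "continuous_map ?T euclideanreal (\<lambda>x. N (k x))" if "affine_hom R S k" for k
      unfolding N_def using uf[OF _ that] F
      by (intro continuous_map_sum continuous_map_real_pow) auto
    have "compact ((\<lambda>x. N (f x)) ` points R)"
      using image_compactin[OF _ cont[OF f], of "points R"] affine_rep_compact[OF aR] top
      by (simp add: compact_space_def)
    moreover have ne: "points R \<noteq> {}" using aR by (simp add: affine_rep_def)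
    ultimately obtain z where z: "z \<in> points R" "\<And>x. x \<in> points R \<Longrightarrow> N (f x) \<le> N (f z)"
      using compact_attains_sup[of "(\<lambda>x. N (f x)) ` points R"] by auto
    \<comment> \<open>Since \<open>f\<close> is onto, the maximum of \<open>N\<close> along
      \<open>f\<close> is its maximum over all of \<open>points S\<close>, and so it bounds
      \<open>N (h x)\<close> as well as \<open>N (f x)\<close>.\<close>
    have max: "N y \<le> N (f z)" if "y \<in> points S" for y
      using that z affine_hom_onto[OF aR S f] by (metis imageE)
    \<comment> \<open>The midpoint map is onto too, so the maximizing point \<open>f z\<close> is
      itself a midpoint of some \<open>f x\<close> and \<open>h x\<close>.\<close>
    obtain x where x: "x \<in> points R" "f z = ?m x"
      using affine_hom_onto[OF aR S affine_hom_midpoint[OF aR aS f h]] affine_hom_maps[OF aR f z(1)]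
      by (metis (no_types, lifting) imageE)
    have fx: "f x \<in> points S" and hx: "h x \<in> points S"
      using x affine_hom_maps[OF aR f] affine_hom_maps[OF aR h] by auto
    have um: "u (?m x) = (u (f x) + u (h x)) / 2" if "u \<in> F" for u
      using that F fx hx affine_rep_subset_topspace[OF aS]
      by (subst continuous_functional_def[of "ambient S" u, THEN iffD1, THEN conjunct2, rule_format])
        (auto simp: D_def)
    have "N (f z) = (\<Sum>u\<in>F. ((u (f x) + u (h x)) / 2)\<^sup>2)"
      unfolding N_def x(2) by (rule sum.cong[OF refl]) (simp only: um)
    also have "\<dots> = (\<Sum>u\<in>F. (u (f x))\<^sup>2 / 2 + (u (h x))\<^sup>2 / 2 - (u (f x) - u (h x))\<^sup>2 / 4)"
      by (rule sum.cong) (auto simp: power2_eq_square field_simps)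
    also have "\<dots> = N (f x) / 2 + N (h x) / 2 - (\<Sum>u\<in>F. (u (f x) - u (h x))\<^sup>2) / 4"
      by (simp add: N_def sum_subtractf sum.distrib sum_divide_distrib)
    finally have "(\<Sum>u\<in>F. (u (f x) - u (h x))\<^sup>2) \<le> 0"
      using max[OF fx] max[OF hx] by simp
    then have "(\<Sum>u\<in>F. (u (f x) - u (h x))\<^sup>2) = 0" by (simp add: antisym sum_nonneg)
    then have "\<forall>u\<in>F. u (f x) = u (h x)" using F by (simp add: sum_nonneg_eq_0_iff)
    with x show ?thesis by blast
  qed
  \<comment> \<open>Any finitely many of the sets \<open>E u\<close> meet, so by compactness they
    all do.\<close>
  have "points R \<inter> \<Inter> (E ` D) \<noteq> {}"
  proof -
    have "compactin ?T (points R)" using affine_rep_compact[OF aR] top by (simp add: compact_space_def)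
    moreover have "points R \<inter> \<Inter> \<F> \<noteq> {}" if FD: "finite \<F>" "\<F> \<subseteq> E ` D" for \<F>
    proof -
      obtain F where "F \<subseteq> D" "finite F" "\<F> = E ` F" using finite_subset_image[OF FD] by blast
      then show ?thesis using fin[of F] by (fastforce simp: E_def)
    qed
    ultimately show ?thesis using clE unfolding compactin_fip by (metis (no_types, lifting) imageE)
  qed
  then obtain z where z: "z \<in> points R" "\<And>u. u \<in> D \<Longrightarrow> u (f z) = u (h z)" by (auto simp: E_def)
  then have "f z = h z"
    using aS affine_hom_maps[OF aR f] affine_hom_maps[OF aR h] affine_rep_subset_topspace[OF aS]
    unfolding affine_rep_def point_separating_dual_def D_def by blast
  then have ne: "{x \<in> points R. f x = h x} \<noteq> {}" using z by blast
  \<comment> \<open>One point of agreement suffices: the coincidence set is closed, convex and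
    invariant, so irreducibility of \<open>R\<close> makes it all of
    \<open>points R\<close>.\<close>
  have "closedin ?T {x \<in> points R. f x = h x}"
    using closedin_continuous_maps_eq[OF affine_rep_Hausdorff[OF aS], of ?T f h] f h
    unfolding affine_hom_def top by blast
  moreover have "convex {x \<in> points R. f x = h x}"
    using aR f h by (intro convex_equalizer_preserves) (auto simp: affine_rep_def affine_hom_def)
  moreover have "invariant_subset R {x \<in> points R. f x = h x}"
    using f h affine_rep_act[OF aR] by (auto simp: invariant_subset_def affine_hom_def equivariant_def)
  ultimately have "{x \<in> points R. f x = h x} = points R"
    using R ne unfolding irreducible_affine_rep_def by blast
  with x show ?thesis by blast
qed

section \<open>Transport along an embedding and copies in the universe type\<close>

text \<open>Transport of structure along \<open>e\<close>, intended for \<open>e\<close> injective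
  on \<open>points Q\<close>, where \<open>inv_into\<close> is a genuine inverse.\<close>

definition image_rep :: "('g, 'a) rep \<Rightarrow> 'b topology \<Rightarrow> ('a \<Rightarrow> 'b) \<Rightarrow> ('g, 'b) rep" where
  "image_rep Q Y e =
     \<lparr>ambient = Y, points = e ` points Q, act = (\<lambda>g y. e (act Q g (inv_into (points Q) e y)))\<rparr>"

lemma image_rep_sel [simp]:
  "ambient (image_rep Q Y e) = Y"
  "points (image_rep Q Y e) = e ` points Q"
  "act (image_rep Q Y e) g y = e (act Q g (inv_into (points Q) e y))"
  by (simp_all add: image_rep_def)

text \<open>A continuous injection of a compact space into a Hausdorff space is a homeomorphism onto
  its image, so the inverse is continuous and everything can be carried across
  \<open>e\<close>.\<close>

lemma irreducible_image_rep:
  fixes Q :: "('g::topological_group_add, 'a::real_vector) rep" and Y :: "'b::real_vector topology"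
  assumes Q: "irreducible_affine_rep Q"
    and Y: "topological_linear_space Y" "point_separating_dual Y"
    and ce: "continuous_map (points_topology Q) Y e"
    and pe: "preserves_convex_combinations (points Q) e"
    and inj: "inj_on e (points Q)"
  shows "irreducible_affine_rep (image_rep Q Y e)" (is ?irr)
    and "affine_hom (image_rep Q Y e) Q (inv_into (points Q) e)" (is ?inv)
proof -
  let ?i = "inv_into (points Q) e" and ?S = "image_rep Q Y e"
  let ?T = "points_topology Q" and ?U = "subtopology Y (e ` points Q)"
  have aQ: "affine_rep Q" using Q by (simp add: irreducible_affine_rep_def)
  note top = topspace_points_topology[OF aQ]
  have ie: "?i (e x) = x" if "x \<in> points Q" for x using inj that by (rule inv_into_f_f)
  have imY: "e ` points Q \<subseteq> topspace Y"
    using ce top by (metis continuous_map_image_subset_topspace)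
  have ce': "continuous_map ?T ?U e" by (rule continuous_map_into_subtopology[OF ce]) (auto simp: top)
  have "homeomorphic_map ?T ?U e"
  proof (rule continuous_imp_homeomorphic_map[OF ce' affine_rep_compact[OF aQ]])
    show "Hausdorff_space ?U" using Y by (simp add: topological_linear_space_def Hausdorff_space_subtopology)
    show "e ` topspace ?T = topspace ?U" unfolding top using imY by auto
    show "inj_on e (topspace ?T)" unfolding top by (rule inj)
  qed
  then obtain k where k: "homeomorphic_maps ?T ?U e k" by (auto simp: homeomorphic_map_maps)
  have ci: "continuous_map ?U ?T ?i"
  proof (rule continuous_map_eq)
    show "continuous_map ?U ?T k" using k by (simp add: homeomorphic_maps_def)
    fix y assume "y \<in> topspace ?U"
    then obtain x where "x \<in> points Q" "y = e x" by auto
    then show "k y = ?i y" using k ie unfolding homeomorphic_maps_def top by simp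
  qed
  have cv: "convex (points Q)" using aQ by (simp add: affine_rep_def)
  have pi: "preserves_convex_combinations (e ` points Q) ?i"
    by (rule preserves_convex_combinations_inv[OF pe cv ie])
  have actm: "act Q g x \<in> points Q" if "x \<in> points Q" for g x by (rule affine_rep_act[OF aQ that])
  have caQ: "continuous_action Q" using aQ by (simp add: affine_rep_def)
  show ?inv
    using ci pi ie actm by (auto simp: affine_hom_def equivariant_def)
  have "continuous_action ?S"
    unfolding continuous_action_def
  proof (intro conjI allI ballI)
    have "continuous_map (prod_topology euclidean ?U) (prod_topology euclidean ?T) (\<lambda>z. (fst z, ?i (snd z)))"
      by (intro continuous_map_pairedI continuous_map_fst continuous_map_compose[OF continuous_map_snd ci, unfolded o_def])
    moreover have "continuous_map (prod_topology euclidean ?T) ?T (\<lambda>(g, x). act Q g x)"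
      using caQ by (simp add: continuous_action_def)
    ultimately have "continuous_map (prod_topology euclidean ?U) ?U
        (e \<circ> ((\<lambda>(g, x). act Q g x) \<circ> (\<lambda>z. (fst z, ?i (snd z)))))"
      using ce' by (blast intro: continuous_map_compose)
    then show "continuous_map (prod_topology euclidean (points_topology ?S)) (points_topology ?S)
        (\<lambda>(g, x). act ?S g x)"
      by (simp add: o_def case_prod_unfold)
    fix y assume "y \<in> points ?S"
    then obtain x where x: "x \<in> points Q" "y = e x" by auto
    show "act ?S 0 y = y" using caQ x ie by (simp add: continuous_action_def)
    show "act ?S (g + h) y = act ?S g (act ?S h y)" for g h
      using caQ x ie actm by (simp add: continuous_action_def)
  qed
  moreover have "preserves_convex_combinations (points ?S) (act ?S g)" for g
  proof -
    have "preserves_convex_combinations (points Q) (act Q g)" using aQ by (simp add: affine_rep_def)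
    then have "preserves_convex_combinations (points Q) (\<lambda>x. e (act Q g x))"
      using pe actm unfolding preserves_convex_combinations_def by simp
    moreover have "?i y \<in> points Q" if "y \<in> e ` points Q" for y using that ie by auto
    ultimately show ?thesis
      using pi unfolding preserves_convex_combinations_def by simp
  qed
  moreover have "compactin Y (e ` points Q)"
    using image_compactin[OF _ ce] affine_rep_compact[OF aQ] top unfolding compact_space_def by metis
  moreover have "points Q \<noteq> {}" using aQ by (simp add: affine_rep_def)
  ultimately have aS: "affine_rep ?S"
    using Y convex_image_preserves[OF pe cv] by (simp add: affine_rep_def)
  have "C = points ?S"
    if C: "closedin (points_topology ?S) C" "convex C" "C \<noteq> {}" "invariant_subset ?S C" for C
  proof -
    \<comment> \<open>Pulling \<open>C\<close> back along \<open>e\<close> keeps it closed, convex,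
      non-empty and invariant, so irreducibility of \<open>Q\<close> applies.\<close>
    let ?D = "{x \<in> points Q. e x \<in> C}"
    have CS: "C \<subseteq> e ` points Q" using C(4) by (simp add: invariant_subset_def)
    have "closedin ?T ?D"
      using closedin_continuous_map_preimage[OF ce', of C] C(1) unfolding top by simp
    moreover have "convex ?D" by (rule convex_preimage_preserves[OF pe cv C(2)])
    moreover have "?D \<noteq> {}" using C(3) CS by auto
    moreover have "invariant_subset Q ?D"
      unfolding invariant_subset_def
    proof (intro conjI allI ballI)
      fix g x assume x: "x \<in> ?D"
      then have "act ?S g (e x) \<in> C" using C(4) unfolding invariant_subset_def by blast
      then show "act Q g x \<in> ?D" using x ie actm by simp
    qed auto
    ultimately have "?D = points Q" using Q unfolding irreducible_affine_rep_def by blast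
    then show ?thesis using CS by auto
  qed
  with aS show ?irr unfolding irreducible_affine_rep_def by blast
qed

definition affine_functionals :: "('g, 'a::real_vector) rep \<Rightarrow> ('a \<Rightarrow> real) set" where
  "affine_functionals Q =
     {f. continuous_map (points_topology Q) euclideanreal f \<and> preserves_convex_combinations (points Q) f}"

text \<open>By irreducibility, a continuous affine function is known from its values on a single
  orbit. This is what allows such functions to be encoded as functions on the group.\<close>

lemma affine_functional_determined:
  assumes Q: "irreducible_affine_rep Q" and v: "v \<in> points Q"
    and f: "f \<in> affine_functionals Q" and h: "h \<in> affine_functionals Q"
    and eq: "\<And>g. f (act Q g v) = h (act Q g v)" and x: "x \<in> points Q"
  shows "f x = h x"
proof -
  have aQ: "affine_rep Q" using Q by (simp add: irreducible_affine_rep_def)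
  note top = topspace_points_topology[OF aQ]
  have caQ: "continuous_action Q" using aQ by (simp add: affine_rep_def)
  \<comment> \<open>Agreement is demanded along the whole orbit of \<open>x\<close>, which makes
    \<open>C\<close> invariant; agreement at \<open>x\<close> itself is the case
    \<open>g = 0\<close>.\<close>
  define C where "C = {x \<in> points Q. \<forall>g. f (act Q g x) = h (act Q g x)}"
  have Ceq: "C = (\<Inter>g. {x \<in> points Q. f (act Q g x) = h (act Q g x)})" by (auto simp: C_def)
  have "closedin (points_topology Q) {x \<in> points Q. f (act Q g x) = h (act Q g x)}" for g
    using closedin_continuous_maps_eq[OF _
        continuous_map_compose[OF continuous_act[OF caQ], of _ f g, unfolded o_def]
        continuous_map_compose[OF continuous_act[OF caQ], of _ h g, unfolded o_def], of euclideanreal] f h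
    unfolding top affine_functionals_def by simp
  then have "closedin (points_topology Q) C" unfolding Ceq by (intro closedin_Inter) auto
  moreover have "convex C"
  proof -
    have "convex {x \<in> points Q. f (act Q g x) = h (act Q g x)}" for g
      using aQ f h affine_rep_act[OF aQ]
      by (intro convex_equalizer_preserves)
        (simp_all add: affine_rep_def affine_functionals_def preserves_convex_combinations_def)
    then show ?thesis unfolding Ceq by (intro convex_INT) auto
  qed
  moreover have "C \<noteq> {}" using v eq by (auto simp: C_def)
  moreover have "invariant_subset Q C"
    unfolding invariant_subset_def
  proof (intro conjI allI ballI)
    fix g x assume x: "x \<in> C"
    have "act Q k (act Q g x) = act Q (k + g) x" for k
      using caQ x by (simp add: continuous_action_def C_def)
    then show "act Q g x \<in> C" using x affine_rep_act[OF aQ] by (simp add: C_def)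
  qed (auto simp: C_def)
  ultimately have "C = points Q" using Q unfolding irreducible_affine_rep_def by blast
  then have "f (act Q 0 x) = h (act Q 0 x)" using x by (auto simp: C_def)
  then show ?thesis using caQ x by (simp add: continuous_action_def)
qed

text \<open>
  Unlike in the embedding described with the universe, the functionals here are affine rather than
  linear. This includes the constants, so the copy lies in the hyperplane \<open>y (\<lambda>_. 1) = 1\<close>, and the
  cone over it, taken in the same type, is a copy of the degenerate conic representation.
\<close>

lemma irreducible_affine_rep_universe:
  fixes Q :: "('g::topological_group_add, 'a::real_vector) rep"
  assumes Q: "irreducible_affine_rep Q"
  obtains S :: "('g, 'g universe) rep" and e' where
    "irreducible_affine_rep S" "ambient S = euclidean" "\<forall>y\<in>points S. y (\<lambda>_. 1) = 1"
    "affine_hom S Q e'"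
proof -
  have aQ: "affine_rep Q" using Q by (simp add: irreducible_affine_rep_def)
  note top = topspace_points_topology[OF aQ]
  obtain v where v: "v \<in> points Q" using aQ by (auto simp: affine_rep_def)
  let ?A = "affine_functionals Q"
  \<comment> \<open>\<open>orb f\<close> is the coordinate under which \<open>f\<close> is stored;
    on \<open>points Q\<close> it determines \<open>f\<close>.\<close>
  define orb where "orb f = (\<lambda>g. f (act Q g v))" for f :: "'a \<Rightarrow> real"
  \<comment> \<open>Choose a functional for each orbit function. Any other index receives the zero
    functional, so every coordinate of \<open>e\<close> is continuous and affine.\<close>
  define rp where "rp \<phi> = (if \<exists>f\<in>?A. orb f = \<phi> then SOME f. f \<in> ?A \<and> orb f = \<phi> else (\<lambda>_. 0))" for \<phi>
  define e :: "'a \<Rightarrow> 'g universe" where "e x = (\<lambda>\<phi>. rp \<phi> x)" for x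
  have const: "(\<lambda>_. c) \<in> ?A" for c
    by (auto simp: affine_functionals_def preserves_convex_combinations_def distrib_right[symmetric])
  have rpA: "rp \<phi> \<in> ?A" for \<phi>
    using const someI_ex[of "\<lambda>f. f \<in> ?A \<and> orb f = \<phi>"] by (auto simp: rp_def)
  \<comment> \<open>The functional chosen for \<open>orb f\<close> may differ from \<open>f\<close>,
    but it has the same orbit function and so agrees with \<open>f\<close> on
    \<open>points Q\<close>.\<close>
  have e_orb: "e x (orb f) = f x" if f: "f \<in> ?A" and x: "x \<in> points Q" for f x
  proof -
    have "orb (rp (orb f)) = orb f"
      using f someI_ex[of "\<lambda>h. h \<in> ?A \<and> orb h = orb f"] by (auto simp: rp_def)
    then show ?thesis
      using affine_functional_determined[OF Q v rpA f _ x] unfolding e_def orb_def by metis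
  qed
  have ce: "continuous_map (points_topology Q) euclidean e"
    using rpA unfolding euclidean_product_topology[symmetric] continuous_map_componentwise_UNIV e_def
    by (simp add: affine_functionals_def)
  have pe: "preserves_convex_combinations (points Q) e"
    using rpA unfolding preserves_convex_combinations_def affine_functionals_def e_def
    by (simp add: fun_eq_iff plus_fun_def scaleR_fun_def)
  \<comment> \<open>A continuous functional separating two points restricts to an affine function,
    whose values can be read off from \<open>e\<close> by \<open>e_orb\<close>.\<close>
  have inj: "inj_on e (points Q)"
  proof (rule inj_onI, rule ccontr)
    fix x y assume x: "x \<in> points Q" and y: "y \<in> points Q" and exy: "e x = e y" and "x \<noteq> y"
    then obtain f where f: "continuous_functional (ambient Q) f" "f x \<noteq> f y"
      using aQ affine_rep_subset_topspace[OF aQ] unfolding affine_rep_def point_separating_dual_def by blast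
    have "f \<in> ?A"
      using f(1) affine_rep_subset_topspace[OF aQ]
      by (auto simp: affine_functionals_def continuous_functional_def preserves_convex_combinations_def
          subset_iff intro: continuous_map_from_subtopology)
    then show False using e_orb[of f] x y exy f(2) by metis
  qed
  let ?S = "image_rep Q euclidean e"
  note S = irreducible_image_rep[OF Q topological_linear_space_fun point_separating_dual_fun ce pe inj]
  have "y (\<lambda>_. 1) = 1" if y: "y \<in> points ?S" for y
  proof -
    obtain x where x: "x \<in> points Q" "y = e x" using y by auto
    \<comment> \<open>The constant function \<open>1\<close> is affine and its orbit function is
      again constantly \<open>1\<close>.\<close>
    then show ?thesis using e_orb[OF const[of 1] x(1)] by (simp add: orb_def)
  qed
  then show ?thesis using that[of ?S "inv_into (points Q) e"] S by simp
qed

section \<open>Invariant functionals and sections of conic representations\<close>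

text \<open>Such an \<open>L\<close> amounts to a conic homomorphism to the half-line with trivial
  action; its level set at \<open>1\<close> is a section preserved by the group.\<close>

definition invariant_functional :: "('g, 'a::real_vector) rep \<Rightarrow> ('a \<Rightarrow> real) \<Rightarrow> bool" where
  "invariant_functional R L \<longleftrightarrow>
     continuous_map (points_topology R) euclideanreal L \<and>
     positive_functional (points R) L \<and>
     (\<forall>g. \<forall>x\<in>points R. L (act R g x) = L x)"

definition section_rep :: "('g, 'a) rep \<Rightarrow> ('a \<Rightarrow> real) \<Rightarrow> ('g, 'a) rep" where
  "section_rep R L = \<lparr>ambient = ambient R, points = {x \<in> points R. L x = 1}, act = act R\<rparr>"

lemma section_rep_sel [simp]:
  "ambient (section_rep R L) = ambient R"
  "points (section_rep R L) = {x \<in> points R. L x = 1}"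
  "act (section_rep R L) = act R"
  by (simp_all add: section_rep_def)

lemma conic_rep_act:
  "conic_rep R \<Longrightarrow> x \<in> points R \<Longrightarrow> act R g x \<in> points R"
  by (metis conic_rep_def is_cone_def continuous_action_maps)

lemma conic_rep_topspace: "conic_rep R \<Longrightarrow> topspace (points_topology R) = points R"
  by (auto simp: conic_rep_def is_cone_def)

text \<open>A conic representation comes with some compact section \<open>M = 1\<close>, and the
  radial projection dividing by \<open>L x\<close> maps it continuously onto the section
  \<open>L = 1\<close>.\<close>

lemma compact_section:
  fixes R :: "('g::topological_group_add, 'b::real_vector) rep"
  assumes R: "conic_rep R" and L: "invariant_functional R L"
  shows "compactin (ambient R) {x \<in> points R. L x = 1}"
proof -
  let ?V = "points R"
  have X: "topological_linear_space (ambient R)" and V: "closed_under_cone_ops ?V"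
    using R by (simp_all add: conic_rep_def is_cone_def)
  have pL: "positive_functional ?V L" and cL: "continuous_map (points_topology R) euclideanreal L"
    using L by (simp_all add: invariant_functional_def)
  obtain M :: "'b \<Rightarrow> real" where M: "preserves_nonneg_combinations ?V M" "\<forall>x\<in>?V. x \<noteq> 0 \<longrightarrow> M x > 0"
    and K: "compactin (ambient R) {x \<in> ?V. M x = 1}"
    using R unfolding conic_rep_def is_section_def by blast
  have pM: "positive_functional ?V M" using M by (simp add: positive_functional_def)
  \<comment> \<open>A point with \<open>M x = 1\<close> is not the apex, so \<open>L x\<close> is
    non-zero there and can be divided by.\<close>
  have sub: "{x \<in> ?V. M x = 1} \<subseteq> {x \<in> ?V. L x \<noteq> 0}"
    using positive_functional_eq_0_iff[OF pL] positive_functional_eq_0_iff[OF pM] by fastforce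
  have "compactin (ambient R) ((\<lambda>x. x /\<^sub>R L x) ` {x \<in> ?V. M x = 1})"
    by (rule image_compactin[OF _ continuous_map_into_fulltopology[OF continuous_map_normalize[OF X V pL cL]]])
      (use K sub in \<open>simp add: compactin_subtopology\<close>)
  moreover have "(\<lambda>x. x /\<^sub>R L x) ` {x \<in> ?V. M x = 1} = {x \<in> ?V. L x = 1}"
  proof (intro equalityI subsetI)
    fix y assume "y \<in> (\<lambda>x. x /\<^sub>R L x) ` {x \<in> ?V. M x = 1}"
    then show "y \<in> {x \<in> ?V. L x = 1}" using sub positive_functional_normalize[OF V pL] by blast
  next
    fix y assume y: "y \<in> {x \<in> ?V. L x = 1}"
    then have "y \<noteq> 0" using positive_functional_zero[OF pL] by auto
    then have My: "M y > 0" using M y by blast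
    have "L (y /\<^sub>R M y) = inverse (M y)" using positive_functional_scaleR[OF pL, of y "inverse (M y)"] y My by simp
    \<comment> \<open>This exhibits \<open>y\<close> as the radial projection of
      \<open>y /\<^sub>R M y\<close>.\<close>
    then have "y = (y /\<^sub>R M y) /\<^sub>R L (y /\<^sub>R M y)" using My by simp
    moreover have "y /\<^sub>R M y \<in> {x \<in> ?V. M x = 1}"
      using y My by (intro positive_functional_normalize[OF V pM]) auto
    ultimately show "y \<in> (\<lambda>x. x /\<^sub>R L x) ` {x \<in> ?V. M x = 1}"
      by (rule image_eqI)
  qed
  ultimately show ?thesis by simp
qed

lemma nonempty_section:
  assumes R: "conic_rep R" and L: "invariant_functional R L"
  obtains x where "x \<in> points R" "L x = 1"
proof -
  obtain v where v: "v \<in> points R" "v \<noteq> 0" using R by (auto simp: conic_rep_def)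
  then have "v /\<^sub>R L v \<in> {x \<in> points R. L x = 1}"
    using R L by (intro positive_functional_normalize)
      (auto simp: conic_rep_def is_cone_def invariant_functional_def positive_functional_eq_0_iff)
  with that show ?thesis by blast
qed

text \<open>The cone over a closed convex invariant part \<open>C\<close> of the section is a closed
  invariant sub-cone, hence everything; since \<open>L\<close> reads off the scalar in
  \<open>t *\<^sub>R x\<close>, its level \<open>1\<close> is just \<open>C\<close>.\<close>

lemma irreducible_section_rep:
  assumes R: "irreducible_conic_rep R" and L: "invariant_functional R L"
  shows "irreducible_affine_rep (section_rep R L)"
proof -
  let ?V = "points R" and ?K = "{x \<in> points R. L x = 1}"
  have cR: "conic_rep R" using R by (simp add: irreducible_conic_rep_def)
  have X: "topological_linear_space (ambient R)" and V: "closed_under_cone_ops ?V"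
    and sep: "point_separating_dual (ambient R)" and VX: "?V \<subseteq> topspace (ambient R)"
    using cR by (simp_all add: conic_rep_def is_cone_def)
  have pL: "positive_functional ?V L" and cL: "continuous_map (points_topology R) euclideanreal L"
    using L by (simp_all add: invariant_functional_def)
  have actK: "act R g x \<in> ?K" if "x \<in> ?K" for g x
    using that conic_rep_act[OF cR] L by (simp add: invariant_functional_def)
  have ca: "continuous_action R" using cR by (simp add: conic_rep_def)
  have "continuous_action (section_rep R L)"
    unfolding continuous_action_def section_rep_sel
  proof (intro conjI)
    let ?T = "subtopology (ambient R) ?K"
    have emb: "continuous_map ?T (points_topology R) (\<lambda>x. x)"
      by (intro continuous_map_into_subtopology continuous_map_id_subt[unfolded id_def]) auto
    have "continuous_map (prod_topology euclidean ?T) (prod_topology euclidean (points_topology R))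
        (\<lambda>z. (fst z, snd z))"
      by (intro continuous_map_pairedI continuous_map_fst
          continuous_map_compose[OF continuous_map_snd emb, unfolded o_def])
    moreover have "continuous_map (prod_topology euclidean (points_topology R)) (points_topology R)
        (\<lambda>(g, x). act R g x)"
      using ca by (simp add: continuous_action_def)
    ultimately have "continuous_map (prod_topology euclidean ?T) (points_topology R)
        ((\<lambda>(g, x). act R g x) \<circ> (\<lambda>z. (fst z, snd z)))"
      by (rule continuous_map_compose)
    then show "continuous_map (prod_topology euclidean ?T) ?T (\<lambda>(g, x). act R g x)"
      using actK by (intro continuous_map_into_subtopology)
        (auto simp: o_def intro: continuous_map_into_fulltopology)
  qed (use ca in \<open>auto simp: continuous_action_def\<close>)
  moreover have "preserves_convex_combinations ?K (act R g)" for g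
    using cR by (intro preserves_nonneg_imp_convex) (auto simp: conic_rep_def)
  ultimately have aK: "affine_rep (section_rep R L)"
    using X sep compact_section[OF cR L] convex_section[OF V pL] nonempty_section[OF cR L]
    unfolding affine_rep_def by auto
  have "C = ?K"
    if C: "closedin (subtopology (ambient R) ?K) C" "convex C" "C \<noteq> {}" "invariant_subset (section_rep R L) C" for C
  proof -
    let ?W = "{t *\<^sub>R x | x t. x \<in> C \<and> 0 \<le> t}"
    have CK: "C \<subseteq> ?K" using C(4) by (simp add: invariant_subset_def)
    have WV: "?W \<subseteq> ?V" using CK cone_scaleR[OF V] by blast
    have LW: "L (t *\<^sub>R x) = t" if "x \<in> C" "0 \<le> t" for t x
      using that CK positive_functional_scaleR[OF pL, of x t] by auto
    \<comment> \<open>Closedness of \<open>?W\<close> is seen on its complement: off the apex, which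
      lies in \<open>?W\<close>, a point belongs to \<open>?W\<close> exactly when its normalization
      belongs to \<open>C\<close>, and normalization is continuous on the open set
      \<open>?N\<close>.\<close>
    have "openin (points_topology R) (?V - ?W)"
    proof -
      let ?N = "{x \<in> ?V. L x \<noteq> 0}"
      have "openin (points_topology R) {x \<in> topspace (points_topology R). L x \<in> - {0}}"
        by (rule openin_continuous_map_preimage[OF cL]) (auto simp: open_closed)
      then have N: "openin (points_topology R) ?N" unfolding conic_rep_topspace[OF cR] by simp
      have NT: "subtopology (points_topology R) ?N = subtopology (ambient R) ?N"
        by (simp add: subtopology_subtopology Int_absorb1 Collect_conj_eq)
      have "openin (subtopology (ambient R) ?K) (?K - C)"
        using C(1) CK VX by (auto simp: closedin_def Int_absorb1 subset_iff)
      then have "openin (subtopology (ambient R) ?N)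
          {x \<in> topspace (subtopology (ambient R) ?N). x /\<^sub>R L x \<in> ?K - C}"
        by (rule openin_continuous_map_preimage[OF continuous_map_normalize[OF X V pL cL]])
      then have "openin (points_topology R) {x \<in> topspace (subtopology (ambient R) ?N). x /\<^sub>R L x \<in> ?K - C}"
        using N unfolding NT[symmetric] by (rule openin_trans_full)
      moreover have "{x \<in> topspace (subtopology (ambient R) ?N). x /\<^sub>R L x \<in> ?K - C} = ?V - ?W"
      proof (intro equalityI subsetI)
        fix x assume x: "x \<in> {x \<in> topspace (subtopology (ambient R) ?N). x /\<^sub>R L x \<in> ?K - C}"
        have "x \<notin> ?W"
        proof
          assume "x \<in> ?W"
          then obtain c t where ct: "c \<in> C" "0 \<le> t" "x = t *\<^sub>R c" by blast
          then have "x /\<^sub>R L x = c" using LW x by simp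
          then show False using x ct by simp
        qed
        then show "x \<in> ?V - ?W" using x by auto
      next
        fix x assume x: "x \<in> ?V - ?W"
        \<comment> \<open>The apex is \<open>0 *\<^sub>R c\<close> and hence in \<open>?W\<close>,
          so a point outside \<open>?W\<close> is non-zero.\<close>
        obtain c where "c \<in> C" using C(3) by blast
        then have "x \<noteq> 0" using x by force
        then have Lx: "L x \<noteq> 0" using x positive_functional_eq_0_iff[OF pL] by blast
        have "x /\<^sub>R L x \<notin> C"
        proof
          assume "x /\<^sub>R L x \<in> C"
          moreover have "x = L x *\<^sub>R (x /\<^sub>R L x)" "0 \<le> L x"
            using Lx x positive_functional_nonneg[OF pL] by auto
          ultimately show False using x by blast
        qed
        then show "x \<in> {x \<in> topspace (subtopology (ambient R) ?N). x /\<^sub>R L x \<in> ?K - C}"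
          using x Lx VX positive_functional_normalize[OF V pL, of x] by auto
      qed
      ultimately show ?thesis by simp
    qed
    then have "closedin (points_topology R) ?W"
      using WV unfolding closedin_def conic_rep_topspace[OF cR] by simp
    moreover have "closed_under_cone_ops ?W" by (rule cone_over_convex[OF C(2)])
    moreover have "\<exists>x\<in>?W. x \<noteq> 0"
    proof -
      obtain c where c: "c \<in> C" using C(3) by blast
      then have "c \<noteq> 0" using CK positive_functional_zero[OF pL, of c] by auto
      moreover have "c = 1 *\<^sub>R c" "(0::real) \<le> 1" by simp_all
      ultimately show ?thesis using c by blast
    qed
    moreover have "invariant_subset R ?W"
      unfolding invariant_subset_def
    proof (intro conjI WV allI ballI)
      fix g x assume "x \<in> ?W"
      then obtain c t where ct: "c \<in> C" "0 \<le> t" "x = t *\<^sub>R c" by blast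
      then have "act R g x = t *\<^sub>R act R g c"
        using cR CK preserves_scaleR[of ?V "act R g" c t] by (auto simp: conic_rep_def)
      moreover have "act R g c \<in> C" using C(4) ct by (simp add: invariant_subset_def)
      ultimately show "act R g x \<in> ?W" using ct by blast
    qed
    ultimately have W: "?W = ?V" using R unfolding irreducible_conic_rep_def by blast
    have "?K \<subseteq> C"
    proof
      fix x assume x: "x \<in> ?K"
      then have "x \<in> ?W" unfolding W by blast
      then obtain c t where ct: "c \<in> C" "0 \<le> t" "x = t *\<^sub>R c" by blast
      then have "t = 1" using LW x by simp
      then show "x \<in> C" using ct by simp
    qed
    with CK show ?thesis by blast
  qed
  with aK show ?thesis unfolding irreducible_affine_rep_def section_rep_sel by blast
qed

lemma invariant_functional_proportional:
  assumes R: "irreducible_conic_rep R" and L: "invariant_functional R L" and M: "invariant_functional R M"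
  obtains c where "c > 0" "\<And>x. x \<in> points R \<Longrightarrow> M x = c * L x"
proof -
  let ?V = "points R"
  have cR: "conic_rep R" using R by (simp add: irreducible_conic_rep_def)
  obtain v where v: "v \<in> ?V" "v \<noteq> 0" using cR by (auto simp: conic_rep_def)
  \<comment> \<open>This ratio makes \<open>M\<close> and \<open>c * L\<close> agree at the non-zero
    point \<open>v\<close>, so that the sub-cone \<open>?W\<close> is non-zero.\<close>
  define c where "c = M v / L v"
  have pos: "L v > 0" "M v > 0" using v L M by (auto simp: invariant_functional_def positive_functional_def)
  let ?W = "{x \<in> ?V. M x = c * L x}"
  have "closedin (points_topology R) {x \<in> topspace (points_topology R). M x = c * L x}"
    using L M by (intro closedin_continuous_maps_eq[of euclideanreal] continuous_map_real_mult)
      (auto simp: invariant_functional_def)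
  then have "closedin (points_topology R) ?W" unfolding conic_rep_topspace[OF cR] .
  moreover have "closed_under_cone_ops ?W"
    using cR L M unfolding conic_rep_def is_cone_def closed_under_cone_ops_def invariant_functional_def
      positive_functional_def preserves_nonneg_combinations_def by (simp add: algebra_simps)
  moreover have "\<exists>x\<in>?W. x \<noteq> 0" using v pos by (intro bexI[of _ v]) (auto simp: c_def)
  moreover have "invariant_subset R ?W"
    using conic_rep_act[OF cR] L M by (auto simp: invariant_subset_def invariant_functional_def)
  ultimately have "?W = ?V" using R unfolding irreducible_conic_rep_def by blast
  then show ?thesis using that[of c] pos by (auto simp: c_def)
qed

section \<open>Cones over affine representations within the same space\<close>

text \<open>When \<open>l\<close> is \<open>1\<close> on \<open>points S\<close>, it plays the role
  of the height coordinate of the degenerate conic representation. The cone thus stays in the type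
  of \<open>S\<close>, so for \<open>S\<close> in the universe type it can be tested against the
  universal property.\<close>

definition cone_over :: "('g, 'a::real_vector) rep \<Rightarrow> ('a \<Rightarrow> real) \<Rightarrow> ('g, 'a) rep" where
  "cone_over S l =
     \<lparr>ambient = ambient S, points = {t *\<^sub>R x | x t. x \<in> points S \<and> 0 \<le> t},
      act = (\<lambda>g y. l y *\<^sub>R act S g (y /\<^sub>R l y))\<rparr>"

lemma cone_over_sel [simp]:
  "ambient (cone_over S l) = ambient S"
  "points (cone_over S l) = {t *\<^sub>R x | x t. x \<in> points S \<and> 0 \<le> t}"
  "act (cone_over S l) g y = l y *\<^sub>R act S g (y /\<^sub>R l y)"
  by (simp_all add: cone_over_def)

lemma continuous_functional_nonneg_combinations:
  "continuous_functional X l \<Longrightarrow> V \<subseteq> topspace X \<Longrightarrow> preserves_nonneg_combinations V l"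
  by (auto simp: continuous_functional_def preserves_nonneg_combinations_def subset_iff)

lemma continuous_functional_scaleR:
  assumes "continuous_functional X l" "x \<in> topspace X"
  shows "l (t *\<^sub>R x) = t * l x"
proof -
  have "l (t *\<^sub>R x + 0 *\<^sub>R x) = t * l x + 0 * l x"
    using assms unfolding continuous_functional_def by blast
  then show ?thesis by simp
qed

text \<open>The level \<open>l = 1\<close> of the cone gives back \<open>points S\<close>. A closed
  non-zero invariant sub-cone meets it in a non-empty closed convex invariant set, hence contains
  \<open>points S\<close> and with it the whole cone.\<close>

lemma irreducible_cone_over:
  fixes S :: "('g::topological_group_add, 'a::real_vector) rep"
  assumes S: "irreducible_affine_rep S" and l: "continuous_functional (ambient S) l"
    and l1: "\<forall>x\<in>points S. l x = 1"
  shows "irreducible_conic_rep (cone_over S l)" and "invariant_functional (cone_over S l) l"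
proof -
  let ?P = "{t *\<^sub>R x | x t. x \<in> points S \<and> 0 \<le> t}" and ?C = "cone_over S l"
  let ?T = "subtopology (ambient S) ?P"
  have aS: "affine_rep S" using S by (simp add: irreducible_affine_rep_def)
  have X: "topological_linear_space (ambient S)" and sep: "point_separating_dual (ambient S)"
    and cS: "continuous_action S" and SX: "points S \<subseteq> topspace (ambient S)"
    using aS affine_rep_subset_topspace[OF aS] by (simp_all add: affine_rep_def)
  have PX: "?P \<subseteq> topspace (ambient S)"
    using X SX by (auto simp: topological_linear_space_def subspace_def)
  have cone: "closed_under_cone_ops ?P" using aS by (intro cone_over_convex) (simp add: affine_rep_def)
  have lt: "l (t *\<^sub>R x) = t" if "x \<in> points S" for t x
    using continuous_functional_scaleR[OF l] SX that l1 by auto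
  have "l y > 0" if y: "y \<in> ?P" "y \<noteq> 0" for y
  proof -
    obtain t x where tx: "x \<in> points S" "0 \<le> t" "y = t *\<^sub>R x" using y by blast
    then have "t \<noteq> 0" using y by auto
    then show ?thesis using tx lt by simp
  qed
  then have pl: "positive_functional ?P l"
    using continuous_functional_nonneg_combinations[OF l PX] by (simp add: positive_functional_def)
  have cl: "continuous_map ?T euclideanreal l"
    using l by (simp add: continuous_functional_def continuous_map_from_subtopology)
  have sec: "{y \<in> ?P. l y = 1} = points S"
  proof (intro equalityI subsetI)
    fix y assume y: "y \<in> {y \<in> ?P. l y = 1}"
    then obtain t x where tx: "x \<in> points S" "0 \<le> t" "y = t *\<^sub>R x" by blast
    then show "y \<in> points S" using y lt by simp
  next
    fix y assume y: "y \<in> points S"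
    moreover have "y = 1 *\<^sub>R y" "(0::real) \<le> 1" by simp_all
    ultimately show "y \<in> {y \<in> ?P. l y = 1}" using l1 by blast
  qed
  have actS: "act S g x \<in> points S" if "x \<in> points S" for g x by (rule affine_rep_act[OF aS that])
  \<comment> \<open>For \<open>t = 0\<close> the formula divides by \<open>l 0 = 0\<close>, but the
    outer factor is \<open>0\<close> as well, so both sides vanish.\<close>
  have act_tx: "act ?C g (t *\<^sub>R x) = t *\<^sub>R act S g x" if "x \<in> points S" for g t x
    using lt[OF that, of t] by (cases "t = 0") simp_all
  have act_sec: "act ?C g y \<in> ?P" if "y \<in> ?P" for g y
  proof -
    obtain t x where tx: "x \<in> points S" "0 \<le> t" "y = t *\<^sub>R x" using \<open>y \<in> ?P\<close> by blast
    then show ?thesis using act_tx[OF tx(1)] actS[OF tx(1)] by blast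
  qed
  \<comment> \<open>The action on the cone is the homogeneous extension of \<open>act S g\<close>
    from the section \<open>l = 1\<close>.\<close>
  have comb: "preserves_nonneg_combinations ?P (act ?C g)" for g
    using homogeneous_extension[OF cone pl, of "act S g"] aS unfolding sec cone_over_sel
    by (simp add: affine_rep_def)
  \<comment> \<open>Joint continuity in the group element and the point: where the height vanishes,
    the values of \<open>act S\<close> remain in the compact set \<open>points S\<close>, which
    settles continuity there.\<close>
  have "continuous_map (prod_topology euclidean ?T) (ambient S)
      (\<lambda>z. l (snd z) *\<^sub>R act S (fst z) (snd z /\<^sub>R l (snd z)))"
  proof (rule continuous_map_scaleR_compact[OF X, of "points S"])
    let ?Y = "prod_topology (euclidean :: 'g topology) ?T" and ?N = "{z. l (snd z) \<noteq> 0}"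
    show "compactin (ambient S) (points S)" using aS by (simp add: affine_rep_def)
    show "continuous_map ?Y euclideanreal (\<lambda>z. l (snd z))"
      by (rule continuous_map_compose[OF continuous_map_snd cl, unfolded o_def])
    have "continuous_map (subtopology ?Y ?N) (subtopology (ambient S) {y \<in> ?P. l y \<noteq> 0}) snd"
      by (intro continuous_map_into_subtopology continuous_map_from_subtopology
          continuous_map_into_fulltopology[OF continuous_map_snd]) (auto, blast)
    from continuous_map_compose[OF this continuous_map_normalize[OF X cone pl cl]]
    have "continuous_map (subtopology ?Y ?N) (points_topology S) (\<lambda>z. snd z /\<^sub>R l (snd z))"
      unfolding sec by (simp add: o_def)
    then have "continuous_map (subtopology ?Y ?N) (prod_topology euclidean (points_topology S))
        (\<lambda>z. (fst z, snd z /\<^sub>R l (snd z)))"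
      by (intro continuous_map_pairedI continuous_map_from_subtopology[OF continuous_map_fst])
    moreover have "continuous_map (prod_topology euclidean (points_topology S)) (ambient S) (\<lambda>(g, x). act S g x)"
      using cS unfolding continuous_action_def by (blast intro: continuous_map_into_fulltopology)
    ultimately have "continuous_map (subtopology ?Y ?N) (ambient S)
        ((\<lambda>(g, x). act S g x) \<circ> (\<lambda>z. (fst z, snd z /\<^sub>R l (snd z))))"
      by (rule continuous_map_compose)
    then show "continuous_map (subtopology ?Y ?N) (ambient S) (\<lambda>z. act S (fst z) (snd z /\<^sub>R l (snd z)))"
      by (simp add: o_def)
    fix z assume z: "z \<in> topspace ?Y" "l (snd z) \<noteq> 0"
    then have "snd z \<in> ?P"
      by (simp only: topspace_prod_topology topspace_subtopology mem_Times_iff Int_iff)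
    then show "act S (fst z) (snd z /\<^sub>R l (snd z)) \<in> points S"
      using positive_functional_normalize[OF cone pl _ z(2)] actS unfolding sec by blast
  qed
  then have "continuous_map (prod_topology euclidean (points_topology ?C)) (points_topology ?C)
      (\<lambda>(g, y). act ?C g y)"
    unfolding case_prod_unfold cone_over_sel
    by (rule continuous_map_into_subtopology) (use act_sec in \<open>unfold cone_over_sel, force\<close>)
  then have "continuous_action ?C"
    unfolding continuous_action_def
  proof (intro conjI allI ballI)
    fix y assume "y \<in> points ?C"
    then obtain t x where tx: "x \<in> points S" "0 \<le> t" "y = t *\<^sub>R x" by auto
    show "act ?C 0 y = y"
      using cS tx(1) unfolding tx(3) act_tx[OF tx(1)] by (simp add: continuous_action_def)
    show "act ?C (g + h) y = act ?C g (act ?C h y)" for g h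
      using cS tx(1) unfolding tx(3) act_tx[OF tx(1)] act_tx[OF actS[OF tx(1)]]
      by (simp add: continuous_action_def)
  qed
  moreover have "is_cone (ambient S) ?P" using X sep PX cone by (simp add: is_cone_def)
  moreover have "is_section (ambient S) ?P (points S)"
    unfolding is_section_def
  proof (intro exI conjI)
    show "continuous_map ?T (top_of_set {0..}) l"
      by (rule continuous_map_into_subtopology[OF cl]) (use positive_functional_nonneg[OF pl] in auto)
    show "points S = {x \<in> ?P. l x = 1}" by (rule sec[symmetric])
  qed (use pl in \<open>simp_all add: positive_functional_def\<close>)
  moreover have "\<exists>x\<in>?P. x \<noteq> 0"
  proof -
    obtain x where x: "x \<in> points S" using aS by (auto simp: affine_rep_def)
    then have "x \<noteq> 0" using lt[OF x, of 0] bspec[OF l1 x] by auto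
    then show ?thesis using x sec by blast
  qed
  ultimately have cC: "conic_rep ?C"
    using comb aS unfolding conic_rep_def cone_over_sel(1,2) by (auto simp: affine_rep_def)
  have "W = points ?C"
    if W: "closedin (points_topology ?C) W" "closed_under_cone_ops W" "\<exists>x\<in>W. x \<noteq> 0" "invariant_subset ?C W" for W
  proof -
    have WP: "W \<subseteq> ?P" using W(4) by (simp add: invariant_subset_def)
    let ?D = "points S \<inter> W"
    have "points S \<subseteq> ?P" using sec by blast
    then have "closedin (points_topology S) ?D"
      using W(1) unfolding cone_over_sel closedin_subtopology by blast
    moreover have "convex ?D"
      using aS convex_cone[OF W(2)] by (auto simp: affine_rep_def intro: convex_Int)
    moreover have "?D \<noteq> {}"
    proof -
      obtain y where y: "y \<in> W" "y \<noteq> 0" using W(3) by blast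
      then have ly: "l y > 0" using pl WP by (auto simp: positive_functional_def)
      then have "y /\<^sub>R l y \<in> W" using cone_scaleR[OF W(2) y(1)] by simp
      moreover have "y /\<^sub>R l y \<in> points S"
        using positive_functional_normalize[OF cone pl, of y] y WP ly sec by auto
      ultimately show ?thesis by blast
    qed
    moreover have "invariant_subset S ?D"
      unfolding invariant_subset_def
    proof (intro conjI allI ballI)
      fix g x assume x: "x \<in> ?D"
      then have "act ?C g x \<in> W" using W(4) by (auto simp: invariant_subset_def)
      then show "act S g x \<in> ?D" using act_tx[of x g 1] x actS by auto
    qed auto
    ultimately have "?D = points S" using S unfolding irreducible_affine_rep_def by blast
    then have "?P \<subseteq> W" using cone_scaleR[OF W(2)] by blast
    with WP show ?thesis by simp
  qed
  with cC show "irreducible_conic_rep ?C" unfolding irreducible_conic_rep_def by blast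
  have "l (act ?C g y) = l y" if "y \<in> ?P" for g y
  proof -
    obtain t x where tx: "x \<in> points S" "0 \<le> t" "y = t *\<^sub>R x" using \<open>y \<in> ?P\<close> by blast
    then show ?thesis unfolding tx(3) act_tx[OF tx(1)] using lt actS by simp
  qed
  then show "invariant_functional ?C l"
    using pl cl unfolding invariant_functional_def cone_over_sel(1,2) by blast
qed

section \<open>From conic homomorphisms to affine homomorphisms of sections\<close>

lemma conic_hom_maps:
  assumes "conic_rep R" "conic_hom R S F" "x \<in> points R"
  shows "F x \<in> points S"
proof -
  have "F \<in> topspace (points_topology R) \<rightarrow> topspace (points_topology S)"
    using assms(2) unfolding conic_hom_def by (blast dest: continuous_map_funspace)
  then show ?thesis using assms(3) unfolding conic_rep_topspace[OF assms(1)] by (auto simp: Pi_iff)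
qed

text \<open>Strict positivity survives the composition because a conic homomorphism vanishes at no
  non-zero point.\<close>

lemma invariant_functional_pullback:
  assumes R: "conic_rep R" and F: "conic_hom R S F" and l: "invariant_functional S l"
  shows "invariant_functional R (\<lambda>x. l (F x))"
  using F l conic_hom_maps[OF R F]
    continuous_map_compose[of "points_topology R" "points_topology S" F euclideanreal l]
  unfolding conic_hom_def invariant_functional_def positive_functional_def equivariant_def
    preserves_nonneg_combinations_def o_def by simp

text \<open>The pulled-back height is a multiple \<open>c\<close> of \<open>L\<close>, so
  \<open>F\<close> maps the section \<open>L = 1\<close> into height \<open>c\<close>; dividing by
  \<open>c\<close> brings it down to \<open>points S\<close>.\<close>

lemma affine_hom_of_conic_hom:
  assumes R: "irreducible_conic_rep R" and L: "invariant_functional R L"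
    and S: "irreducible_affine_rep S" and l: "continuous_functional (ambient S) l"
    and l1: "\<forall>x\<in>points S. l x = 1"
    and F: "conic_hom R (cone_over S l) F"
  obtains f where "affine_hom (section_rep R L) S f"
proof -
  have cR: "conic_rep R" using R by (simp add: irreducible_conic_rep_def)
  have X: "topological_linear_space (ambient S)" and SX: "points S \<subseteq> topspace (ambient S)"
    using S affine_rep_subset_topspace[of S] by (auto simp: irreducible_affine_rep_def affine_rep_def)
  obtain c where c: "c > 0" "\<And>x. x \<in> points R \<Longrightarrow> l (F x) = c * L x"
    using invariant_functional_proportional[OF R L
        invariant_functional_pullback[OF cR F irreducible_cone_over(2)[OF S l l1]]] by blast
  let ?K = "{x \<in> points R. L x = 1}" and ?f = "\<lambda>x. F x /\<^sub>R c"
  have f: "?f x \<in> points S" if x: "x \<in> ?K" for x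
  proof -
    have "F x \<in> points (cone_over S l)" using conic_hom_maps[OF cR F] x by blast
    then obtain t y where ty: "y \<in> points S" "F x = t *\<^sub>R y" by auto
    \<comment> \<open>Compare heights: \<open>l (F x)\<close> is \<open>t\<close> because
      \<open>l y = 1\<close>, and it is \<open>c\<close> because \<open>L x = 1\<close>.\<close>
    then have "t = c" using c(2)[of x] x continuous_functional_scaleR[OF l, of y t] SX l1 by auto
    then show ?thesis using ty c(1) by simp
  qed
  have "continuous_map (subtopology (ambient R) ?K) (ambient S) F"
    using F unfolding conic_hom_def cone_over_sel
    by (auto intro: continuous_map_from_subtopology_mono continuous_map_into_fulltopology)
  then have "continuous_map (subtopology (ambient R) ?K) (ambient S) ?f"
    by (intro continuous_map_tls_scaleR[OF X]) auto
  then have "continuous_map (subtopology (ambient R) ?K) (points_topology S) ?f"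
    by (rule continuous_map_into_subtopology) (use f in auto)
  moreover have "?f (act R g x) = act S g (?f x)" if "x \<in> ?K" for g x
    using F c that by (auto simp: conic_hom_def equivariant_def)
  moreover have "preserves_convex_combinations ?K ?f"
    using F unfolding conic_hom_def preserves_nonneg_combinations_def preserves_convex_combinations_def
    by (simp add: scaleR_add_right mult.commute)
  ultimately have "affine_hom (section_rep R L) S ?f"
    by (simp add: affine_hom_def equivariant_def)
  with that show ?thesis .
qed

section \<open>Isomorphism with a degenerate conic representation\<close>

text \<open>Mutually inverse affine homomorphisms between the section and \<open>Q\<close> extend
  homogeneously to mutually inverse conic homomorphisms.\<close>

lemma conic_isomorphic_degenerate:
  assumes R: "conic_rep R" and L: "invariant_functional R L" and Q: "affine_rep Q"
    and f: "affine_hom (section_rep R L) Q f" and h: "affine_hom Q (section_rep R L) h"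
    and hf: "\<And>x. x \<in> points (section_rep R L) \<Longrightarrow> h (f x) = x"
    and fh: "\<And>y. y \<in> points Q \<Longrightarrow> f (h y) = y"
  shows "conic_isomorphic R (degenerate_conic_rep Q)"
proof -
  let ?V = "points R" and ?K = "{x \<in> points R. L x = 1}" and ?D = "degenerate_conic_rep Q"
  let ?W = "points ?D" and ?Y = "prod_topology (ambient Q) euclideanreal"
  have ambD: "ambient ?D = ?Y" by (simp add: degenerate_conic_rep_def)
  have W: "?W = {(t *\<^sub>R x, t) | x t. x \<in> points Q \<and> 0 \<le> t}" by (simp add: degenerate_conic_rep_def)
  have X: "topological_linear_space (ambient R)" and V: "closed_under_cone_ops ?V"
    using R by (simp_all add: conic_rep_def is_cone_def)
  have XQ: "topological_linear_space (ambient Q)" and QX: "points Q \<subseteq> topspace (ambient Q)"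
    using Q affine_rep_subset_topspace[OF Q] by (simp_all add: affine_rep_def)
  have XY: "topological_linear_space ?Y"
    by (rule topological_linear_space_prod[OF XQ topological_linear_space_real])
  have pL: "positive_functional ?V L" and cL: "continuous_map (points_topology R) euclideanreal L"
    using L by (simp_all add: invariant_functional_def)
  have K: "compactin (ambient R) ?K" by (rule compact_section[OF R L])
  have KX: "?K \<subseteq> topspace (ambient R)" using compactin_subset_topspace[OF K] .
  have fQ: "f x \<in> points Q" if "x \<in> ?K" for x
  proof -
    have "f \<in> topspace (points_topology (section_rep R L)) \<rightarrow> topspace (points_topology Q)"
      using f unfolding affine_hom_def by (blast dest: continuous_map_funspace)
    then show ?thesis using that KX by auto
  qed
  have hK: "h y \<in> ?K" if "y \<in> points Q" for y using affine_hom_maps[OF Q h that] by simp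

  \<comment> \<open>\<open>?F\<close> extends \<open>f\<close> and records \<open>L x\<close> as the
    height.\<close>
  let ?F = "\<lambda>x. (L x *\<^sub>R f (x /\<^sub>R L x), L x)"
  \<comment> \<open>\<open>?H\<close> is written as the homogeneous extension of
    \<open>\<lambda>z. h (fst z)\<close> with respect to the functional \<open>snd\<close>, so that
    the same extension lemmas serve both directions.\<close>
  let ?H = "\<lambda>z. snd z *\<^sub>R h (fst (z /\<^sub>R snd z))"
  have FW: "?F x \<in> ?W" if "x \<in> ?V" for x
  proof (cases "L x = 0")
    case True
    obtain q where "q \<in> points Q" using Q by (auto simp: affine_rep_def)
    moreover have "?F x = (0 *\<^sub>R q, 0)" using True by simp
    ultimately show ?thesis unfolding W by blast
  next
    case False
    then have "f (x /\<^sub>R L x) \<in> points Q" using fQ positive_functional_normalize[OF V pL that] by blast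
    then show ?thesis unfolding W using positive_functional_nonneg[OF pL that] by blast
  qed
  have W_cone: "closed_under_cone_ops ?W"
  proof -
    have "convex (points Q \<times> {1::real})" using Q by (intro convex_Times) (simp_all add: affine_rep_def)
    \<comment> \<open>The degenerate cone is the cone over a copy of \<open>points Q\<close> at
      height \<open>1\<close>.\<close>
    moreover have "?W = {t *\<^sub>R z | z t. z \<in> points Q \<times> {1} \<and> 0 \<le> t}" by (auto simp: W)
    ultimately show ?thesis by (simp only: cone_over_convex)
  qed
  have "preserves_nonneg_combinations ?W snd" by (simp add: preserves_nonneg_combinations_def)
  then have psnd: "positive_functional ?W snd"
    by (auto simp: positive_functional_def W zero_prod_def)
  have secW: "{z \<in> ?W. snd z = 1} = points Q \<times> {1}" by (auto simp: W)
  have csnd: "continuous_map (subtopology ?Y ?W) euclideanreal snd"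
    by (intro continuous_map_from_subtopology continuous_map_snd)
  have HV: "?H z \<in> ?V" and LH: "L (?H z) = snd z" and HF: "?H z = 0 \<longrightarrow> z = 0" if z: "z \<in> ?W" for z
  proof -
    obtain q t where q: "q \<in> points Q" "0 \<le> t" "z = (t *\<^sub>R q, t)" using z unfolding W by blast
    show 1: "?H z \<in> ?V"
      using q hK[OF q(1)] cone_scaleR[OF V, of "h q" t] cone_zero[OF V, of "h q"] by (cases "t = 0") auto
    show 2: "L (?H z) = snd z"
      using q hK[OF q(1)] positive_functional_scaleR[OF pL, of "h q" t] positive_functional_zero[OF pL, of "h q"]
      by (cases "t = 0") auto
    show "?H z = 0 \<longrightarrow> z = 0"
    proof
      assume "?H z = 0"
      with 2 have "L 0 = snd z" by (simp only:)
      then have "snd z = 0" using positive_functional_zero[OF pL, of "h q"] hK[OF q(1)] by simp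
      then have "t = 0" by (simp add: q)
      then show "z = 0" by (simp add: q zero_prod_def)
    qed
  qed
  have actR: "act R g (t *\<^sub>R x) = t *\<^sub>R act R g x" if "x \<in> ?V" "0 \<le> t" for g t x
    using R that preserves_scaleR[of ?V "act R g" x t] by (simp add: conic_rep_def)

  have "conic_hom R ?D ?F"
    unfolding conic_hom_def
  proof (intro conjI)
    have "continuous_map (points_topology R) (ambient Q) (\<lambda>x. L x *\<^sub>R f (x /\<^sub>R L x))"
      using f by (intro continuous_homogeneous_extension[OF X V pL cL K XQ])
        (auto simp: affine_hom_def intro: continuous_map_into_fulltopology)
    then have "continuous_map (points_topology R) ?Y ?F" by (intro continuous_map_pairedI cL)
    then show "continuous_map (points_topology R) (points_topology ?D) ?F"
      unfolding ambD by (rule continuous_map_into_subtopology) (use FW in auto)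
    show "equivariant R ?D ?F"
      unfolding equivariant_def
    proof (intro allI ballI)
      fix g x assume x: "x \<in> ?V"
      have Lg: "L (act R g x) = L x" using L x by (simp add: invariant_functional_def)
      have "L x *\<^sub>R f (act R g x /\<^sub>R L x) = L x *\<^sub>R act Q g (f (x /\<^sub>R L x))"
      proof (cases "L x = 0")
        case False
        have "act R g x /\<^sub>R L x = act R g (x /\<^sub>R L x)"
          using actR[OF x] positive_functional_nonneg[OF pL x] by simp
        then show ?thesis
          using f positive_functional_normalize[OF V pL x False] by (simp add: affine_hom_def equivariant_def)
      qed simp
      then show "?F (act R g x) = act ?D g (?F x)"
        unfolding act_degenerate_conic_rep Lg by simp
    qed
    have "preserves_convex_combinations ?K f" using f by (simp add: affine_hom_def)
    from homogeneous_extension[OF V pL this] show "preserves_nonneg_combinations ?V ?F"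
      using pL by (simp add: positive_functional_def preserves_nonneg_combinations_def)
    show "\<forall>x\<in>?V. x \<noteq> 0 \<longrightarrow> ?F x \<noteq> 0"
      using pL by (auto simp: positive_functional_def zero_prod_def)
  qed
  moreover have "conic_hom ?D R ?H"
    unfolding conic_hom_def
  proof (intro conjI)
    have hX: "continuous_map (points_topology Q) (ambient R) h"
      using h by (auto simp: affine_hom_def intro: continuous_map_into_fulltopology)
    have "continuous_map (subtopology ?Y ?W) (ambient R) ?H"
    proof (rule continuous_homogeneous_extension[OF XY W_cone psnd csnd _ X])
      show "compactin ?Y {z \<in> ?W. snd z = 1}"
        unfolding secW using Q by (simp add: compactin_Times affine_rep_def)
      have "continuous_map (subtopology ?Y {z \<in> ?W. snd z = 1}) (points_topology Q) fst"
        unfolding secW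
        by (intro continuous_map_into_subtopology continuous_map_from_subtopology continuous_map_fst) auto
      from continuous_map_compose[OF this hX]
      show "continuous_map (subtopology ?Y {z \<in> ?W. snd z = 1}) (ambient R) (\<lambda>z. h (fst z))"
        by (simp add: o_def)
    qed
    then show "continuous_map (points_topology ?D) (points_topology R) ?H"
      unfolding ambD by (rule continuous_map_into_subtopology) (use HV in auto)
    show "equivariant ?D R ?H"
      unfolding equivariant_def
    proof (intro allI ballI)
      fix g z assume "z \<in> ?W"
      then obtain q t where q: "q \<in> points Q" "0 \<le> t" "z = (t *\<^sub>R q, t)" unfolding W by blast
      have "h (act Q g q) = act R g (h q)" using h q by (simp add: affine_hom_def equivariant_def)
      then show "?H (act ?D g z) = act R g (?H z)"
        using actR[of "h q" t g] actR[of "h q" 0 g] hK[OF q(1)] q(2) unfolding q(3) act_degenerate_conic_rep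
        by (cases "t = 0") auto
    qed
    have "preserves_convex_combinations {z \<in> ?W. snd z = 1} (\<lambda>z. h (fst z))"
      using h unfolding secW by (auto simp: affine_hom_def preserves_convex_combinations_def)
    from homogeneous_extension[OF W_cone psnd this]
    show "preserves_nonneg_combinations ?W ?H" .
    show "\<forall>z\<in>?W. z \<noteq> 0 \<longrightarrow> ?H z \<noteq> 0" using HF by blast
  qed
  moreover have "?H (?F x) = x" if x: "x \<in> ?V" for x
  proof (cases "L x = 0")
    case True
    then show ?thesis using positive_functional_eq_0_iff[OF pL x] by simp
  next
    case False
    then have "h (f (x /\<^sub>R L x)) = x /\<^sub>R L x"
      using hf positive_functional_normalize[OF V pL x] by simp
    then show ?thesis using False by simp
  qed
  moreover have "?F (?H z) = z" if z: "z \<in> ?W" for z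
  proof -
    obtain q t where q: "q \<in> points Q" "0 \<le> t" "z = (t *\<^sub>R q, t)" using z unfolding W by blast
    then show ?thesis unfolding LH[OF z] using fh by (cases "t = 0") auto
  qed
  ultimately show ?thesis unfolding conic_isomorphic_def by blast
qed

section \<open>Consequences of universality\<close>

lemma irreducible_affine_singleton:
  assumes "topological_linear_space X" "point_separating_dual X" "p \<in> topspace X"
  shows "irreducible_affine_rep (\<lparr>ambient = X, points = {p}, act = (\<lambda>_ x. x)\<rparr> ::
    ('g::topological_group_add, 'a::real_vector) rep)"
proof -
  have "continuous_map (prod_topology euclidean (subtopology X {p})) (subtopology X {p}) (\<lambda>(g :: 'g, x). x)"
    by (simp add: case_prod_unfold continuous_map_snd)
  then show ?thesis
    using assms
    by (auto simp: irreducible_affine_rep_def affine_rep_def continuous_action_def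
        preserves_convex_combinations_def invariant_subset_def)
qed

text \<open>Evaluation at the constant function \<open>1\<close> is the height functional for the
  copies placed in the universe type.\<close>

lemma universe_functional:
  "continuous_functional euclidean (\<lambda>y :: 'g universe. y (\<lambda>_. 1))"
  unfolding continuous_functional_def plus_fun_def scaleR_fun_def
  by (intro conjI continuous_map_apply) simp

lemma universal_conic_invariant_functional:
  fixes V :: "('g::topological_group_add, 'a::real_vector) rep"
  assumes V: "universal_irreducible_conic_rep V"
  obtains L where "invariant_functional V L"
proof -
  \<comment> \<open>The half-line with trivial action is realized in the universe type as the cone
    over one fixed point, chosen so that its height is \<open>1\<close>.\<close>
  define S :: "('g, 'g universe) rep" where
    "S = \<lparr>ambient = euclidean, points = {\<lambda>_. 1}, act = (\<lambda>_ x. x)\<rparr>"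
  let ?l = "\<lambda>y :: 'g universe. y (\<lambda>_. 1)"
  have S: "irreducible_affine_rep S"
    unfolding S_def
    by (rule irreducible_affine_singleton[OF topological_linear_space_fun point_separating_dual_fun]) simp
  have l: "continuous_functional (ambient S) ?l" by (simp add: S_def universe_functional)
  have l1: "\<forall>x\<in>points S. ?l x = 1" by (simp add: S_def)
  obtain F where F: "conic_hom V (cone_over S ?l) F"
    using V irreducible_cone_over(1)[OF S l l1] unfolding universal_irreducible_conic_rep_def by blast
  have "conic_rep V"
    using V by (simp add: universal_irreducible_conic_rep_def irreducible_conic_rep_def)
  from invariant_functional_pullback[OF this F irreducible_cone_over(2)[OF S l l1]] show ?thesis
    by (rule that)
qed

text \<open>Universality is stated for the universe type only, so \<open>Q\<close> is replaced by
  its copy \<open>S\<close> there. A homomorphism from \<open>V\<close> to the cone over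
  \<open>S\<close> restricts to the section, and \<open>e'\<close> leads back to
  \<open>Q\<close>.\<close>

lemma universal_section_hom:
  fixes V :: "('g::topological_group_add, 'a::real_vector) rep" and Q :: "('g, 'b::real_vector) rep"
  assumes V: "universal_irreducible_conic_rep V" and L: "invariant_functional V L"
    and Q: "irreducible_affine_rep Q"
  obtains f where "affine_hom (section_rep V L) Q f"
proof -
  have iV: "irreducible_conic_rep V" using V by (simp add: universal_irreducible_conic_rep_def)
  obtain S :: "('g, 'g universe) rep" and e' where S: "irreducible_affine_rep S" "ambient S = euclidean"
    and l1: "\<forall>y\<in>points S. y (\<lambda>_. 1) = 1" and e': "affine_hom S Q e'"
    by (rule irreducible_affine_rep_universe[OF Q])
  have l: "continuous_functional (ambient S) (\<lambda>y. y (\<lambda>_. 1))" by (simp add: S universe_functional)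
  obtain F where F: "conic_hom V (cone_over S (\<lambda>y. y (\<lambda>_. 1))) F"
    using V irreducible_cone_over(1)[OF S(1) l l1] unfolding universal_irreducible_conic_rep_def by blast
  obtain f where f: "affine_hom (section_rep V L) S f"
    by (rule affine_hom_of_conic_hom[OF iV L S(1) l l1 F])
  have "affine_rep (section_rep V L)"
    using irreducible_section_rep[OF iV L] by (simp add: irreducible_affine_rep_def)
  from affine_hom_compose[OF this f e'] that show ?thesis by blast
qed

text \<open>Universality supplies a map in the direction opposite to \<open>h\<close>. Both
  composites are endomorphisms of irreducible affine representations, hence identities by
  uniqueness.\<close>

lemma conic_isomorphic_degenerate_section:
  fixes V :: "('g::topological_group_add, 'a::real_vector) rep" and Q :: "('g, 'b::real_vector) rep"
  assumes V: "universal_irreducible_conic_rep V" and L: "invariant_functional V L"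
    and Q: "irreducible_affine_rep Q" and h: "affine_hom Q (section_rep V L) h"
  shows "conic_isomorphic V (degenerate_conic_rep Q)"
proof -
  have iV: "irreducible_conic_rep V" using V by (simp add: universal_irreducible_conic_rep_def)
  let ?K = "section_rep V L"
  have K: "irreducible_affine_rep ?K" by (rule irreducible_section_rep[OF iV L])
  have aK: "affine_rep ?K" and aQ: "affine_rep Q" using K Q by (simp_all add: irreducible_affine_rep_def)
  obtain f where f: "affine_hom ?K Q f" by (rule universal_section_hom[OF V L Q])
  show ?thesis
  proof (rule conic_isomorphic_degenerate[OF _ L aQ f h])
    show "conic_rep V" using iV by (simp add: irreducible_conic_rep_def)
    show "h (f x) = x" if "x \<in> points ?K" for x
      by (rule affine_hom_unique[OF K K affine_hom_compose[OF aK f h] affine_hom_id that])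
    show "f (h y) = y" if "y \<in> points Q" for y
      by (rule affine_hom_unique[OF Q Q affine_hom_compose[OF aQ h f] affine_hom_id that])
  qed
qed

theorem theorem20:
  fixes V :: "('g::topological_group_add, 'a::real_vector) rep"
  assumes "universal_irreducible_conic_rep V"
  shows "(\<exists>Q :: ('g, 'g universe) rep.
            universal_irreducible_affine_rep Q \<and> conic_isomorphic V (degenerate_conic_rep Q)) \<and>
         (\<forall>Q :: ('g, 'b::real_vector) rep.
            universal_irreducible_affine_rep Q \<longrightarrow> conic_isomorphic V (degenerate_conic_rep Q))"
proof -
  have iV: "irreducible_conic_rep V" using assms by (simp add: universal_irreducible_conic_rep_def)
  obtain L where L: "invariant_functional V L"
    by (rule universal_conic_invariant_functional[OF assms])
  let ?K = "section_rep V L"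
  have K: "irreducible_affine_rep ?K" by (rule irreducible_section_rep[OF iV L])
  \<comment> \<open>The section lives in the type of \<open>V\<close>, so its copy \<open>S\<close>
    in the universe type is taken as the witness.\<close>
  obtain S :: "('g, 'g universe) rep" and e' where S: "irreducible_affine_rep S"
    and "ambient S = euclidean" "\<forall>y\<in>points S. y (\<lambda>_. 1) = 1"
    and e': "affine_hom S ?K e'"
    by (rule irreducible_affine_rep_universe[OF K])
  have aS: "affine_rep S" using S by (simp add: irreducible_affine_rep_def)
  have "\<exists>f. affine_hom S T f \<and> f ` points S = points T"
    if T: "irreducible_affine_rep T" for T :: "('g, 'g universe) rep"
  proof -
    obtain f where "affine_hom ?K T f" by (rule universal_section_hom[OF assms L T])
    from affine_hom_compose[OF aS e' this] show ?thesis using affine_hom_onto[OF aS T] by blast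
  qed
  then have "universal_irreducible_affine_rep S"
    using S by (simp add: universal_irreducible_affine_rep_def)
  moreover have "conic_isomorphic V (degenerate_conic_rep S)"
    by (rule conic_isomorphic_degenerate_section[OF assms L S e'])
  moreover have "conic_isomorphic V (degenerate_conic_rep Q)"
    if Q: "universal_irreducible_affine_rep Q" for Q :: "('g, 'b) rep"
  proof -
    have iQ: "irreducible_affine_rep Q" using Q by (simp add: universal_irreducible_affine_rep_def)
    then have aQ: "affine_rep Q" by (simp add: irreducible_affine_rep_def)
    \<comment> \<open>Testing the universality of \<open>Q\<close> on \<open>S\<close> gives a map
      to \<open>S\<close>, and \<open>e'\<close> continues it to the section.\<close>
    obtain k where "affine_hom Q S k"
      using Q S unfolding universal_irreducible_affine_rep_def by blast
    from affine_hom_compose[OF aQ this e'] show ?thesis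
      by (rule conic_isomorphic_degenerate_section[OF assms L iQ])
  qed
  ultimately show ?thesis by blast
qed

end
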